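(* For generic $a\in\mathfrak h^*$ and all integers $l,\bar l\ge0$, the dimension of the space of operators $V^g_a$ with $g\in\mathcal A_l\otimes\bar{\mathcal A}_{\bar l}$ equals $\dim\mathcal F_l\cdot\dim\mathcal F_{\bar l}$. For every $l\ge 0$, the dimension of the space of operators $V^g_a$ with $g\in\mathcal A_l$, and the dimension of the space of operators $V^g_a$ with $g\in\bar{\mathcal A}_l$, are both equal to $\dim\mathcal F_l$. Here the numbers $\dim\mathcal F_l$ are defined by $$\sum_{l=0}^\infty q^l\dim\mathcal F_l=\prod_{m=1}^\infty\frac1{(1-q^m)^{L-1}}.$$
   Context: Fix an integer $L\ge2$ and an irrational $p\in(0,1)$; $\omega=e^{2\pi i/L}$ and $\omega^c:=e^{2\pi i c/L}$ for $c\in\mathbb C$. $\mathfrak h^*$ is the complex dual Cartan subalgebra of the Lie algebra $A_{L-1}$ with its invariant bilinear form $\langle\cdot,\cdot\rangle$ and simple roots $\alpha_1,\dots,\alpha_{L-1}$, $\langle\alpha_i,\alpha_j\rangle=2\delta_{ij}-\delta_{i,j+1}-\delta_{i,j-1}$. $H_1,\dots,H_L\in\mathfrak h^*$ are the weights of the first fundamental representation: $\langle\alpha_i,H_s\rangle=\delta_{is}-\delta_{i,s-1}$, so $\alpha_i=H_i-H_{i+1}$ and $\sum_sH_s=0$. For $S\subseteq\{1,\dots,L\}$ put $H_S=\sum_{s\in S}H_s$. Let $$f(z)=\frac{(z-\omega^p)(z-\omega^{1-p})}{(z-1)(z-\omega)}.$$ "For generic $a$" means: for all $a\in\mathfrak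 h^*$ outside a countable union of zero sets of entire functions on $\mathfrak h^*$ that are not identically zero. **Algebras.** $\mathcal A=\bigoplus_{l\ge0}\mathcal A_l$ is the free commutative (polynomial) $\mathbb C$-algebra on generators $\alpha_ic_{-n}$, $1\le i\le L-1$, $n\ge1$, graded by giving $\alpha_ic_{-n}$ degree (level) $n$; $\bar{\mathcal A}=\bigoplus_l\bar{\mathcal A}_l$ is a second copy with generators $\alpha_i\bar c_{-n}$. $\mathcal A$ and $\bar{\mathcal A}$ are regarded as subalgebras of $\mathcal A\otimes\bar{\mathcal A}$. ($\mathcal F_l$ is the level $l$ subspace of the Fock module of $L-1$ free bosons.) **Rational functions $J^g_{N,a}$.** Let $N\ge0$, $k_1,\dots,k_N\in\{1,\dots,L-1\}$, and let $x_1,\dots,x_N$ be variables. For a tuple $\underline S=(S_1,\dots,S_N)$ of subsets of $\{1,\dots,L\}$ with $|S_n|=k_n$, $S_n=\{s^{(n)}_1<\dots<s^{(n)}_{k_n}\}$, put $y^{(n)}_j=x_n\,\omega^{(k_n+1-2j)/2}$. Define the algebra homomorphism $E_{\underline S}$ from $\mathcal A\otimes\bar{\mathcal A}$ to rational functions of $x_1,\dots,x_N$ by $$E_{\underline S}(\alpha_ic_{-m})=\sum_{n=1}^N\sum_{j=1}^{k_n}\langle\alpha_i,H_{s^{(n)}_j}\rangle\,\omega^{-\frac{L+1-2s^{(n)}_j}{2}m}\,(y^{(n)}_j)^m,$$ $$E_{\underline S}(\alpha_i\bar c_{-m})=\sum_{n=1}^N\sum_{j=1}^{k_n}\langle\alpha_i,H_{L+1-s^{(n)}_j}\rangle\,\omega^{\frac{L+1-2s^{(n)}_j}{2}m}\,(y^{(n)}_j)^{-m}.$$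 Let $\Phi_{\underline S}(x_1,\dots,x_N)$ be the product, over all $m<n$ and all pairs $(j,j')$ with $s^{(m)}_j\ne s^{(n)}_{j'}$, of the factors $f(y^{(m)}_j/y^{(n)}_{j'})$ if $s^{(m)}_j<s^{(n)}_{j'}$ and $f(y^{(n)}_{j'}/y^{(m)}_j)$ if $s^{(m)}_j>s^{(n)}_{j'}$. Then $$J^g_{N,a}(x_1,\dots,x_N)_{k_1\dots k_N}=\sum_{\underline S}\omega^{\langle a,\sum_nH_{S_n}\rangle}\,\Phi_{\underline S}\,E_{\underline S}(g),\qquad g\in\mathcal A\otimes\bar{\mathcal A}.$$ **Operators.** The operator $V^g_a$ is defined by (and identified with) the collection of its form factors, indexed by all $N\ge0$ and $k_1,\dots,k_N\in\{1,\dots,L-1\}$: $$G_a\,f^g_a(\theta_1,\dots,\theta_N)_{k_1\dots k_N},\qquad f^g_a(\theta_1,\dots,\theta_N)_{k_1\dots k_N}=J^g_{N,a}(e^{\theta_1},\dots,e^{\theta_N})_{k_1\dots k_N}\prod_{n}\lambda'_{k_n}\prod_{m<n}R_{k_mk_n}(\theta_m-\theta_n),$$ where $G_a$ is a nonzero constant, $R_{kl}(\theta)=\prod_{r=1}^k\prod_{j=1}^lR\bigl(\theta+\frac{\mathrm i\pi}{L}(k-l-2r+2j)\bigr)$, $R$ is the meromorphic continuation of $$R(\theta)=\exp\Bigl(-4\int_0^\infty\frac{dt}{t}\,\frac{\sinh((L-1)t)\sinh(pt)\sinh((1-p)t)}{\sinh^2(Lt)}\cosh\frac{L(\pi-\mathrm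 i\theta)t}{\pi}\Bigr)$$ (the integral converges for $-2\pi<\operatorname{Im}\theta<0$), and $\lambda'_k=\sqrt{\frac{L}{2\sin\pi p}}\exp\int_0^\infty\frac{dt}{t}\frac{\sinh(pt)\sinh((1-p)t)}{\sinh t\,\sinh^2Lt}\bigl(\sinh^2kt+\sinh^2(L-k)t\bigr)$ are nonzero constants. The map $g\mapsto V^g_a$ is linear, with linear combinations taken in the vector space of collections of meromorphic functions. *)

theory Defs
  imports
    "HOL-Complex_Analysis.Complex_Analysis"
    "HOL-Computational_Algebra.Formal_Power_Series"
    "HOL-Library.Poly_Mapping"
    "HOL-Library.Function_Algebras"
begin

section \<open>The dual Cartan subalgebra of \<open>A\<^sub>L\<^sub>-\<^sub>1\<close>\<close>

text \<open>
  The usual model: vectors of \<open>\<complex>\<^sup>L\<close> with coordinate sum zero, and the standard bilinear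
  (not Hermitian) form.  Vectors are functions vanishing outside \<open>{1..L}\<close>.
\<close>

definition hdual :: "nat \<Rightarrow> (nat \<Rightarrow> complex) set" where
  "hdual L = {a. (\<forall>s. s \<notin> {1..L} \<longrightarrow> a s = 0) \<and> (\<Sum>s=1..L. a s) = 0}"

definition pairing :: "nat \<Rightarrow> (nat \<Rightarrow> complex) \<Rightarrow> (nat \<Rightarrow> complex) \<Rightarrow> complex" where
  "pairing L a b = (\<Sum>s=1..L. a s * b s)"

definition weightH :: "nat \<Rightarrow> nat \<Rightarrow> nat \<Rightarrow> complex" where
  "weightH L s = (\<lambda>t. if t \<in> {1..L} then of_bool (t = s) - 1 / of_nat L else 0)"

definition alpha :: "nat \<Rightarrow> nat \<Rightarrow> nat \<Rightarrow> complex" where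
  "alpha L i = weightH L i - weightH L (Suc i)"

definition weightHset :: "nat \<Rightarrow> nat set \<Rightarrow> nat \<Rightarrow> complex" where
  "weightHset L S = (\<Sum>s\<in>S. weightH L s)"

lemma alpha_apply:
  "alpha L i t = (if t \<in> {1..L} then of_bool (t = i) - of_bool (t = Suc i) else 0)"
  by (simp add: alpha_def weightH_def)

lemma sum_fun_apply: "(\<Sum>s\<in>S. f s) t = (\<Sum>s\<in>S. f s t)"
  for f :: "'b \<Rightarrow> 'c \<Rightarrow> complex"
  by (induction S rule: infinite_finite_induct) auto

lemma sum_of_bool_times:
  fixes g :: "nat \<Rightarrow> complex"
  shows "(\<Sum>t=1..L. of_bool (t = i) * g t) = (if i \<in> {1..L} then g i else 0)"
proof -
  have "(\<Sum>t=1..L. of_bool (t = i) * g t) = (\<Sum>t=1..L. if t = i then g t else 0)"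
    by (intro sum.cong) auto
  then show ?thesis by simp
qed

lemma pairing_alpha:
  assumes "1 \<le> i" "i < L"
  shows "pairing L (alpha L i) v = v i - v (Suc i)"
proof -
  have "pairing L (alpha L i) v =
      (\<Sum>t=1..L. of_bool (t = i) * v t - of_bool (t = Suc i) * v t)"
    unfolding pairing_def by (intro sum.cong) (auto simp: alpha_apply algebra_simps)
  also have "\<dots> = v i - v (Suc i)"
    using assms unfolding sum_subtractf sum_of_bool_times by simp
  finally show ?thesis .
qed

lemma weightH_in_hdual: "s \<in> {1..L} \<Longrightarrow> weightH L s \<in> hdual L"
proof -
  assume s: "s \<in> {1..L}"
  have "(\<Sum>t=1..L. weightH L s t) = (\<Sum>t=1..L. of_bool (t = s) * 1 - 1 / of_nat L)"
    by (intro sum.cong) (auto simp: weightH_def)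
  also have "\<dots> = 0"
    using s unfolding sum_subtractf sum_of_bool_times by simp
  finally show ?thesis by (auto simp: hdual_def weightH_def)
qed

lemma alpha_in_hdual: "1 \<le> i \<Longrightarrow> i < L \<Longrightarrow> alpha L i \<in> hdual L"
  using weightH_in_hdual[of i L] weightH_in_hdual[of "Suc i" L]
  by (auto simp: hdual_def alpha_def sum_subtractf)

lemma pairing_alpha_weightH:
  assumes "1 \<le> i" "i < L" "s \<in> {1..L}"
  shows "pairing L (alpha L i) (weightH L s) = of_bool (i = s) - of_bool (Suc i = s)"
  using assms by (simp add: pairing_alpha weightH_def)

lemma pairing_alpha_alpha:
  assumes "1 \<le> i" "i < L" "1 \<le> j" "j < L"
  shows "pairing L (alpha L i) (alpha L j) =
    2 * of_bool (i = j) - of_bool (i = Suc j) - of_bool (Suc i = j)"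
  using assms by (auto simp: pairing_alpha alpha_apply)

lemma sum_weightH: "(\<Sum>s=1..L. weightH L s) = 0"
proof
  fix t
  show "(\<Sum>s=1..L. weightH L s) t = 0 t"
  proof (cases "t \<in> {1..L}")
    case True
    then have "(\<Sum>s=1..L. weightH L s t) = (\<Sum>s=1..L. of_bool (s = t) * 1 - 1 / of_nat L)"
      by (intro sum.cong) (auto simp: weightH_def)
    also have "\<dots> = 0"
      using True unfolding sum_subtractf sum_of_bool_times by simp
    finally show ?thesis by (simp add: sum_fun_apply)
  next
    case False
    then show ?thesis by (auto simp: sum_fun_apply weightH_def intro!: sum.neutral)
  qed
qed


section \<open>Generic elements\<close>

definition hnorm :: "nat \<Rightarrow> (nat \<Rightarrow> complex) \<Rightarrow> real" where
  "hnorm L v = L2_set (\<lambda>s. cmod (v s)) {1..L}"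

text \<open>
  Entire means complex (Frechet) differentiable at every point of \<open>hdual L\<close>.  Only the values
  of \<open>F\<close> on \<open>hdual L\<close> are relevant.
\<close>

definition entire_on_hdual :: "nat \<Rightarrow> ((nat \<Rightarrow> complex) \<Rightarrow> complex) \<Rightarrow> bool" where
  "entire_on_hdual L F \<longleftrightarrow>
     (\<forall>a\<in>hdual L. \<exists>D.
        (\<forall>u\<in>hdual L. \<forall>v\<in>hdual L. D (u + v) = D u + D v) \<and>
        (\<forall>c. \<forall>v\<in>hdual L. D (\<lambda>s. c * v s) = c * D v) \<and>
        (\<forall>e>0. \<exists>d>0. \<forall>b\<in>hdual L. hnorm L (b - a) < d \<longrightarrow>
           cmod (F b - F a - D (b - a)) \<le> e * hnorm L (b - a)))"

definition generic :: "nat \<Rightarrow> ((nat \<Rightarrow> complex) \<Rightarrow> bool) \<Rightarrow> bool" where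
  "generic L P \<longleftrightarrow>
     (\<exists>\<F>. countable \<F> \<and>
        (\<forall>F\<in>\<F>. entire_on_hdual L F \<and> (\<exists>a\<in>hdual L. F a \<noteq> 0)) \<and>
        (\<forall>a\<in>hdual L. a \<notin> (\<Union>F\<in>\<F>. {b\<in>hdual L. F b = 0}) \<longrightarrow> P a))"


section \<open>The graded algebras\<close>

text \<open>
  \<open>Gen i n\<close> and \<open>GenBar i n\<close> stand for \<open>\<alpha>\<^sub>i c\<^sub>-\<^sub>n\<close> and its barred counterpart; the
  tensor product of the two polynomial algebras is the polynomial algebra in both kinds of
  generators.
\<close>

datatype generator = Gen nat nat | GenBar nat nat

primrec gen_level :: "generator \<Rightarrow> nat" where
  "gen_level (Gen i n) = n"
| "gen_level (GenBar i n) = n"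

type_synonym poly_alg = "(generator \<Rightarrow>\<^sub>0 nat) \<Rightarrow>\<^sub>0 complex"

definition generators :: "nat \<Rightarrow> generator set" where
  "generators L = {Gen i n | i n. 1 \<le> i \<and> i \<le> L - 1 \<and> 1 \<le> n}"

definition generators_bar :: "nat \<Rightarrow> generator set" where
  "generators_bar L = {GenBar i n | i n. 1 \<le> i \<and> i \<le> L - 1 \<and> 1 \<le> n}"

definition level :: "(generator \<Rightarrow>\<^sub>0 nat) \<Rightarrow> nat" where
  "level \<mu> = (\<Sum>v\<in>Poly_Mapping.keys \<mu>. Poly_Mapping.lookup \<mu> v * gen_level v)"

definition alg :: "nat \<Rightarrow> nat \<Rightarrow> poly_alg set" where
  "alg L l = {g. \<forall>\<mu>\<in>Poly_Mapping.keys g. Poly_Mapping.keys \<mu> \<subseteq> generators L \<and> level \<mu> = l}"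

definition alg_bar :: "nat \<Rightarrow> nat \<Rightarrow> poly_alg set" where
  "alg_bar L l = {g. \<forall>\<mu>\<in>Poly_Mapping.keys g. Poly_Mapping.keys \<mu> \<subseteq> generators_bar L \<and> level \<mu> = l}"

definition poly_scale :: "complex \<Rightarrow> poly_alg \<Rightarrow> poly_alg" where
  "poly_scale c g = Poly_Mapping.single 0 c * g"

interpretation poly_alg: vector_space poly_scale
  by unfold_locales
    (simp_all add: poly_scale_def algebra_simps single_add mult_single flip: mult.assoc)

definition alg_tensor :: "nat \<Rightarrow> nat \<Rightarrow> nat \<Rightarrow> poly_alg set" where
  "alg_tensor L l l' = poly_alg.span {g * h | g h. g \<in> alg L l \<and> h \<in> alg_bar L l'}"

definition eval_poly :: "(generator \<Rightarrow> complex) \<Rightarrow> poly_alg \<Rightarrow> complex" where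
  "eval_poly \<phi> g = (\<Sum>\<mu>\<in>Poly_Mapping.keys g. Poly_Mapping.lookup g \<mu> * (\<Prod>v\<in>Poly_Mapping.keys \<mu>. \<phi> v ^ Poly_Mapping.lookup \<mu> v))"


section \<open>The rational functions \<open>J\<close>\<close>

text \<open>
  A tuple \<open>(x\<^sub>1, \<dots>, x\<^sub>N)\<close> is a list of length \<open>N\<close>, numbered from 0; the inner
  indices \<open>j\<close> start at 1.  Rational functions are given by their values; the points where a
  denominator vanishes (and division by zero would return 0) are excluded by
  \<open>regular_point\<close> below.
\<close>

definition omega_pow :: "nat \<Rightarrow> complex \<Rightarrow> complex" where
  "omega_pow L c = exp (2 * of_real pi * \<i> * c / of_nat L)"

definition f_fun :: "nat \<Rightarrow> real \<Rightarrow> complex \<Rightarrow> complex" where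
  "f_fun L p z =
     (z - omega_pow L (of_real p)) * (z - omega_pow L (of_real (1 - p)))
       / ((z - 1) * (z - omega_pow L 1))"

definition subset_tuples :: "nat \<Rightarrow> nat list \<Rightarrow> nat set list set" where
  "subset_tuples L ks =
     {Ss. length Ss = length ks \<and> (\<forall>n<length ks. Ss ! n \<subseteq> {1..L} \<and> card (Ss ! n) = ks ! n)}"

definition elt :: "nat set \<Rightarrow> nat \<Rightarrow> nat" where
  "elt S j = sorted_list_of_set S ! (j - 1)"

definition y_val :: "nat \<Rightarrow> nat list \<Rightarrow> complex list \<Rightarrow> nat \<Rightarrow> nat \<Rightarrow> complex" where
  "y_val L ks xs n j = xs ! n * omega_pow L ((of_nat (ks ! n) + 1 - 2 * of_nat j) / 2)"

fun E_gen :: "nat \<Rightarrow> nat list \<Rightarrow> nat set list \<Rightarrow> complex list \<Rightarrow> generator \<Rightarrow> complex" where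
  "E_gen L ks Ss xs (Gen i m) =
     (\<Sum>n<length ks. \<Sum>j=1..ks ! n. let s = elt (Ss ! n) j in
        pairing L (alpha L i) (weightH L s)
        * omega_pow L (- ((of_nat L + 1 - 2 * of_nat s) / 2) * of_nat m)
        * y_val L ks xs n j ^ m)"
| "E_gen L ks Ss xs (GenBar i m) =
     (\<Sum>n<length ks. \<Sum>j=1..ks ! n. let s = elt (Ss ! n) j in
        pairing L (alpha L i) (weightH L (L + 1 - s))
        * omega_pow L ((of_nat L + 1 - 2 * of_nat s) / 2 * of_nat m)
        * y_val L ks xs n j powi (- int m))"

definition E_hom :: "nat \<Rightarrow> nat list \<Rightarrow> nat set list \<Rightarrow> complex list \<Rightarrow> poly_alg \<Rightarrow> complex" where
  "E_hom L ks Ss xs = eval_poly (E_gen L ks Ss xs)"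

definition Phi :: "nat \<Rightarrow> real \<Rightarrow> nat list \<Rightarrow> nat set list \<Rightarrow> complex list \<Rightarrow> complex" where
  "Phi L p ks Ss xs =
     (\<Prod>n<length ks. \<Prod>m<n. \<Prod>j=1..ks ! m. \<Prod>j'=1..ks ! n.
        let s = elt (Ss ! m) j; s' = elt (Ss ! n) j';
            y = y_val L ks xs m j; y' = y_val L ks xs n j'
        in if s < s' then f_fun L p (y / y')
           else if s > s' then f_fun L p (y' / y)
           else 1)"

definition J_fun ::
  "nat \<Rightarrow> real \<Rightarrow> (nat \<Rightarrow> complex) \<Rightarrow> poly_alg \<Rightarrow> nat list \<Rightarrow> complex list \<Rightarrow> complex" where
  "J_fun L p a g ks xs =
     (\<Sum>Ss\<in>subset_tuples L ks.
        omega_pow L (pairing L a (\<Sum>n<length ks. weightHset L (Ss ! n)))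
        * Phi L p ks Ss xs * E_hom L ks Ss xs g)"


section \<open>Operators as collections of form factors\<close>

definition R_integral :: "nat \<Rightarrow> real \<Rightarrow> complex \<Rightarrow> complex" where
  "R_integral L p \<theta> =
     exp (- 4 * integral {0<..} (\<lambda>t::real.
       of_real (1 / t * (sinh ((real L - 1) * t) * sinh (p * t) * sinh ((1 - p) * t)
                         / (sinh (real L * t))\<^sup>2))
       * cosh (of_nat L * (of_real pi - \<i> * \<theta>) * of_real t / of_real pi)))"

text \<open>
  Since \<open>nicely_meromorphic_on\<close> fixes the values at removable singularities and poles, at most
  one function satisfies this.
\<close>

definition is_R_continuation :: "nat \<Rightarrow> real \<Rightarrow> (complex \<Rightarrow> complex) \<Rightarrow> bool" where
  "is_R_continuation L p R \<longleftrightarrow>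
     R nicely_meromorphic_on UNIV \<and>
     (\<forall>\<theta>. - 2 * pi < Im \<theta> \<and> Im \<theta> < 0 \<longrightarrow> R \<theta> = R_integral L p \<theta>)"

definition R_shift :: "nat \<Rightarrow> nat \<Rightarrow> nat \<Rightarrow> nat \<Rightarrow> nat \<Rightarrow> complex" where
  "R_shift L k l r j =
     \<i> * of_real pi / of_nat L * (of_nat k - of_nat l - 2 * of_nat r + 2 * of_nat j)"

definition R_kl :: "nat \<Rightarrow> (complex \<Rightarrow> complex) \<Rightarrow> nat \<Rightarrow> nat \<Rightarrow> complex \<Rightarrow> complex" where
  "R_kl L R k l \<theta> = (\<Prod>r=1..k. \<Prod>j=1..l. R (\<theta> + R_shift L k l r j))"

definition lambda' :: "nat \<Rightarrow> real \<Rightarrow> nat \<Rightarrow> real" where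
  "lambda' L p k =
     sqrt (real L / (2 * sin (pi * p))) *
     exp (integral {0<..} (\<lambda>t::real.
       1 / t * (sinh (p * t) * sinh ((1 - p) * t) / (sinh t * (sinh (real L * t))\<^sup>2))
       * ((sinh (real k * t))\<^sup>2 + (sinh ((real L - real k) * t))\<^sup>2)))"

text \<open>
  The points of \<open>\<complex>\<^sup>N\<close> avoiding the poles of all the factors \<open>f\<close> and \<open>R\<close>.  The excluded points
  lie on a locally finite family of hyperplanes \<open>\<theta>\<^sub>m - \<theta>\<^sub>n = const\<close>, so the regular points form
  a dense open set on which every form factor is holomorphic.  A meromorphic form factor is
  represented by its restriction to this set (extended by 0), which determines it and is
  compatible with linear combinations.
\<close>

definition regular_point ::
  "nat \<Rightarrow> (complex \<Rightarrow> complex) \<Rightarrow> nat list \<Rightarrow> complex list \<Rightarrow> bool" where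
  "regular_point L R ks \<theta>s \<longleftrightarrow>
     length \<theta>s = length ks \<and>
     (\<forall>n<length ks. \<forall>m<n. \<forall>i\<in>{1..ks ! m}. \<forall>j\<in>{1..ks ! n}.
        (let y = y_val L ks (map exp \<theta>s) m i; y' = y_val L ks (map exp \<theta>s) n j
         in y / y' \<notin> {1, omega_pow L 1} \<and> y' / y \<notin> {1, omega_pow L 1}) \<and>
        R analytic_on {\<theta>s ! m - \<theta>s ! n + R_shift L (ks ! m) (ks ! n) i j})"

type_synonym form_factors = "nat list \<Rightarrow> complex list \<Rightarrow> complex"

definition f_factor ::
  "nat \<Rightarrow> real \<Rightarrow> (complex \<Rightarrow> complex) \<Rightarrow> (nat \<Rightarrow> complex) \<Rightarrow> poly_alg \<Rightarrow> form_factors" where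
  "f_factor L p R a g ks \<theta>s =
     J_fun L p a g ks (map exp \<theta>s)
     * (\<Prod>n<length ks. of_real (lambda' L p (ks ! n)))
     * (\<Prod>n<length ks. \<Prod>m<n. R_kl L R (ks ! m) (ks ! n) (\<theta>s ! m - \<theta>s ! n))"

definition V_op ::
  "nat \<Rightarrow> real \<Rightarrow> (complex \<Rightarrow> complex) \<Rightarrow> ((nat \<Rightarrow> complex) \<Rightarrow> complex) \<Rightarrow>
   (nat \<Rightarrow> complex) \<Rightarrow> poly_alg \<Rightarrow> form_factors" where
  "V_op L p R G a g =
     (\<lambda>ks \<theta>s. if set ks \<subseteq> {1..L - 1} \<and> regular_point L R ks \<theta>s
              then G a * f_factor L p R a g ks \<theta>s else 0)"

definition ff_scale :: "complex \<Rightarrow> form_factors \<Rightarrow> form_factors" where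
  "ff_scale c F = (\<lambda>ks \<theta>s. c * F ks \<theta>s)"

interpretation form_factors: vector_space ff_scale
  by unfold_locales (auto simp: ff_scale_def fun_eq_iff algebra_simps)


section \<open>Dimensions of the Fock module\<close>

text \<open>The infinite product is taken in the topology of formal power series.\<close>

definition dim_F :: "nat \<Rightarrow> nat \<Rightarrow> rat" where
  "dim_F L l = fps_nth (prodinf (\<lambda>m. 1 / (1 - fps_X ^ (m + 1)) ^ (L - 1))) l"

end

theory Submission
  imports Defs "Jordan_Normal_Form.Determinant"
begin

text \<open>
  Let \<open>a\<close> tend to infinity in the direction of a strictly dominant coweight.  Then the sum over
  tuples \<open>S\<close> is dominated by the single term \<open>S\<^sub>n = {1..k\<^sub>n}\<close>, and in this term the generators
  collapse to power sums: \<open>\<alpha>\<^sub>i c\<^sub>-\<^sub>m\<close> becomes a multiple of \<open>\<Sum> x\<^sub>n\<^sup>m\<close> over the particles of kind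
  \<open>i\<close>, and its barred counterpart a multiple of \<open>\<Sum> x\<^sub>n\<^sup>-\<^sup>m\<close> over the particles of kind \<open>L - i\<close>.
  Positive and negative power sums in arbitrarily many variables are algebraically independent,
  so distinct monomials have linearly independent leading terms.  Hence for finitely many
  monomials there are evaluation points at which the determinant of the values of \<open>J\<close> is not
  identically zero in \<open>a\<close>; this determinant is an exponential polynomial in \<open>a\<close>, and off its
  zero set \<open>g \<mapsto> V\<^sup>g\<^sub>a\<close> is injective on the span of these monomials.  Evaluation points are
  taken at real rapidities whose differences avoid the countably many singular values.
\<close>

section \<open>The monomials of a given level and their generating function\<close>

section \<open>Counting monomials\<close>

definition monomials :: "generator set \<Rightarrow> nat \<Rightarrow> (generator \<Rightarrow>\<^sub>0 nat) set" where
  "monomials V l = {\<mu>. Poly_Mapping.keys \<mu> \<subseteq> V \<and> level \<mu> = l}"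

lemma level_eq_sum:
  assumes "finite V" "Poly_Mapping.keys \<mu> \<subseteq> V"
  shows "level \<mu> = (\<Sum>v\<in>V. Poly_Mapping.lookup \<mu> v * gen_level v)"
  unfolding level_def using assms
  by (intro sum.mono_neutral_left) (auto simp: in_keys_iff)

lemma level_add: "level (\<mu> + \<nu>) = level \<mu> + level \<nu>"
proof -
  let ?V = "Poly_Mapping.keys \<mu> \<union> Poly_Mapping.keys \<nu>"
  have "level (\<mu> + \<nu>) = (\<Sum>v\<in>?V. Poly_Mapping.lookup (\<mu> + \<nu>) v * gen_level v)"
    using Poly_Mapping.keys_add[of \<mu> \<nu>] by (intro level_eq_sum) auto
  also have "\<dots> = level \<mu> + level \<nu>"
    by (subst (1 2) level_eq_sum[of ?V])
       (auto simp: lookup_add algebra_simps sum.distrib)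
  finally show ?thesis .
qed

lemma level_single: "level (Poly_Mapping.single v n) = n * gen_level v"
  by (simp add: level_def)

lemma gen_level_le_level:
  assumes "v \<in> Poly_Mapping.keys \<mu>"
  shows "gen_level v \<le> level \<mu>"
proof -
  have "gen_level v \<le> Poly_Mapping.lookup \<mu> v * gen_level v"
    using assms by (simp add: in_keys_iff)
  also have "\<dots> \<le> level \<mu>"
    unfolding level_def using assms by (intro member_le_sum) auto
  finally show ?thesis .
qed

text \<open>A monomial either omits \<open>v\<close> or is divisible by \<open>v\<close>, and
  dividing by \<open>v\<close> once lowers the level by \<open>m\<close>. This is the recursion
  behind the geometric series 1 / (1 - X^m).\<close>

lemma monomials_insert:
  assumes "gen_level v = m" "m \<ge> 1"
  shows "monomials (insert v V) l =
    monomials V l \<union> (if m \<le> l then (\<lambda>\<mu>. \<mu> + Poly_Mapping.single v 1) ` monomials (insert v V) (l - m) else {})"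
    (is "?A = ?B \<union> ?C")
proof
  show "?A \<subseteq> ?B \<union> ?C"
  proof
    fix \<mu> assume \<mu>: "\<mu> \<in> ?A"
    show "\<mu> \<in> ?B \<union> ?C"
    proof (cases "v \<in> Poly_Mapping.keys \<mu>")
      case False
      with \<mu> show ?thesis by (auto simp: monomials_def)
    next
      case True
      define \<nu> where "\<nu> = \<mu> - Poly_Mapping.single v 1"
      have \<mu>\<nu>: "\<mu> = \<nu> + Poly_Mapping.single v 1"
        using True unfolding \<nu>_def
        by (intro poly_mapping_eqI) (auto simp: lookup_add lookup_minus lookup_single in_keys_iff when_def)
      have "Poly_Mapping.keys \<nu> \<subseteq> Poly_Mapping.keys \<mu>"
        by (subst \<mu>\<nu>) (auto simp: in_keys_iff lookup_add)
      moreover have "level \<mu> = level \<nu> + m"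
        using assms by (subst \<mu>\<nu>) (simp add: level_add level_single)
      ultimately have "m \<le> l" "\<nu> \<in> monomials (insert v V) (l - m)"
        using \<mu> by (auto simp: monomials_def)
      then show ?thesis using \<mu>\<nu> by auto
    qed
  qed
next
  have "\<mu> + Poly_Mapping.single v 1 \<in> ?A" if "\<mu> \<in> monomials (insert v V) (l - m)" "m \<le> l" for \<mu>
    using that assms Poly_Mapping.keys_add[of \<mu> "Poly_Mapping.single v 1"]
    by (auto simp: monomials_def level_add level_single)
  then show "?B \<union> ?C \<subseteq> ?A" by (auto simp: monomials_def)
qed

lemma monomials_empty: "monomials {} l = (if l = 0 then {0} else {})"
  by (auto simp: monomials_def level_def)

text \<open>The recursion of \<open>monomials_insert\<close> terminates because a generator of
  positive level strictly lowers the level, so an inner induction on \<open>l\<close> closes the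
  step.\<close>

lemma finite_monomials:
  assumes "finite V" "\<And>v. v \<in> V \<Longrightarrow> gen_level v \<ge> 1"
  shows "finite (monomials V l)"
  using assms
proof (induction V arbitrary: l rule: finite_induct)
  case (insert v V)
  show ?case
  proof (induction l rule: less_induct)
    case (less l)
    have "l - gen_level v < l" if "gen_level v \<le> l"
      using that insert.prems[of v] by simp
    then show ?case
      using less insert by (subst monomials_insert[OF refl]) auto
  qed
qed (simp add: monomials_empty)

text \<open>Read on generating functions, \<open>monomials_insert\<close> says F(insert v V) = F(V)
  + X^m F(insert v V), so each generator contributes one factor 1 / (1 - X^m).\<close>

lemma fps_monomials:
  assumes "finite V" "\<And>v. v \<in> V \<Longrightarrow> gen_level v \<ge> 1"
  shows "Abs_fps (\<lambda>l. of_nat (card (monomials V l)) :: rat) = (\<Prod>v\<in>V. 1 / (1 - fps_X ^ gen_level v))"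
  using assms
proof (induction V rule: finite_induct)
  case empty
  show ?case by (simp add: fps_eq_iff monomials_empty)
next
  case (insert v V)
  let ?F = "\<lambda>V. Abs_fps (\<lambda>l. of_nat (card (monomials V l)) :: rat)"
  let ?m = "gen_level v"
  have m: "?m \<ge> 1" using insert.prems by simp
  have "?F (insert v V) = ?F V + ?F (insert v V) * fps_X ^ ?m"
  proof (rule fps_ext)
    fix l
    let ?C = "if ?m \<le> l then (\<lambda>\<mu>. \<mu> + Poly_Mapping.single v 1) ` monomials (insert v V) (l - ?m) else {}"
    have fin: "finite (monomials W k)" if "W \<subseteq> insert v V" for W k
      using insert that by (intro finite_monomials) (auto intro: finite_subset)
    have "v \<in> Poly_Mapping.keys (\<mu> + Poly_Mapping.single v 1)" for \<mu> :: "generator \<Rightarrow>\<^sub>0 nat"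
      by (simp add: in_keys_iff lookup_add)
    then have "monomials V l \<inter> ?C = {}"
      using insert.hyps by (auto simp: monomials_def)
    then have "card (monomials (insert v V) l) = card (monomials V l) + card ?C"
      using fin by (subst monomials_insert[OF refl m]) (auto intro!: card_Un_disjoint)
    also have "card ?C = (if ?m \<le> l then card (monomials (insert v V) (l - ?m)) else 0)"
      by (auto intro!: card_image inj_onI)
    finally show "fps_nth (?F (insert v V)) l = fps_nth (?F V + ?F (insert v V) * fps_X ^ ?m) l"
      by (auto simp: fps_X_power_mult_right_nth)
  qed
  then have eq: "?F (insert v V) * (1 - fps_X ^ ?m) = ?F V"
    by (simp add: algebra_simps)
  \<comment> \<open>Dividing by a series with nonzero constant coefficient is multiplying by its
    inverse; this is what allows solving for the new series.\<close>
  have unit: "fps_nth (1 - fps_X ^ ?m :: rat fps) 0 \<noteq> 0"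
    using m by simp
  have inv: "1 / (1 - fps_X ^ ?m) = inverse (1 - fps_X ^ ?m :: rat fps)"
    using unit by (simp add: fps_divide_unit)
  have "?F (insert v V) = ?F V * (1 / (1 - fps_X ^ ?m))"
    unfolding inv eq[symmetric] using unit
    by (simp add: mult.assoc inverse_mult_eq_1')
  then show ?case using insert by (simp add: mult.commute)
qed

text \<open>At level \<open>l\<close> only generators of level at most \<open>l\<close> can occur,
  so the counts for finite truncations of the infinite generator set stabilise, which is convergence
  of the partial products coefficient by coefficient. The constructor is a parameter
  \<open>h\<close> so that the barred and unbarred generators are covered at once.\<close>

lemma card_monomials_eq_dim_F:
  fixes L :: nat and h :: "nat \<Rightarrow> nat \<Rightarrow> generator"
  assumes inj: "\<And>i m i' m'. h i m = h i' m' \<Longrightarrow> i = i' \<and> m = m'"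
    and lev: "\<And>i m. gen_level (h i m) = m"
  defines "V \<equiv> {h i m | i m. 1 \<le> i \<and> i \<le> L - 1 \<and> 1 \<le> m}"
  shows "finite (monomials V l)" and "of_nat (card (monomials V l)) = dim_F L l"
proof -
  \<comment> \<open>The generators of levels 1 to \<open>n\<close>; the shift \<open>m + 1\<close>
    matches the factors of the product in \<open>dim_F\<close>, which start at index 0.\<close>
  define W where "W n = (\<lambda>(m, i). h i (m + 1)) ` ({..<n} \<times> {1..L - 1})" for n
  have W: "finite (W n)" "v \<in> W n \<Longrightarrow> gen_level v \<ge> 1" for n v
    by (auto simp: W_def lev)
  have stable: "monomials V l = monomials (W n) l" if "n \<ge> l" for n l
  proof -
    have "Poly_Mapping.keys \<mu> \<subseteq> V \<longleftrightarrow> Poly_Mapping.keys \<mu> \<subseteq> W n" if "level \<mu> = l" for \<mu>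
    proof
      assume *: "Poly_Mapping.keys \<mu> \<subseteq> V"
      show "Poly_Mapping.keys \<mu> \<subseteq> W n"
      proof
        fix v assume v: "v \<in> Poly_Mapping.keys \<mu>"
        with * obtain i m where im: "v = h i m" "1 \<le> i" "i \<le> L - 1" "1 \<le> m"
          by (auto simp: V_def)
        have "m \<le> n" using gen_level_le_level[OF v] that \<open>n \<ge> l\<close> by (simp add: im lev)
        then show "v \<in> W n" unfolding W_def using im
          by (intro image_eqI[of _ _ "(m - 1, i)"]) auto
      qed
    next
      assume "Poly_Mapping.keys \<mu> \<subseteq> W n"
      also have "W n \<subseteq> V" by (force simp: W_def V_def)
      finally show "Poly_Mapping.keys \<mu> \<subseteq> V" .
    qed
    then show ?thesis by (auto simp: monomials_def)
  qed
  show "finite (monomials V l)"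
    using stable[OF order_refl] finite_monomials[OF W] by simp
  let ?F = "Abs_fps (\<lambda>l. of_nat (card (monomials V l)) :: rat)"
  have part: "(\<Prod>m<n. 1 / (1 - fps_X ^ (m + 1)) ^ (L - 1)) =
      Abs_fps (\<lambda>l. of_nat (card (monomials (W n) l)) :: rat)" for n
  proof -
    have "(\<Prod>v\<in>W n. 1 / (1 - fps_X ^ gen_level v)) =
        (\<Prod>(m,i)\<in>{..<n} \<times> {1..L - 1}. 1 / (1 - fps_X ^ (m + 1)) :: rat fps)"
      unfolding W_def using inj
      by (subst prod.reindex) (auto simp: inj_on_def lev intro!: prod.cong)
    also have "\<dots> = (\<Prod>m<n. (1 / (1 - fps_X ^ (m + 1))) ^ (L - 1))"
      by (simp add: prod.cartesian_product[symmetric])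
    also have "\<dots> = (\<Prod>m<n. 1 / (1 - fps_X ^ (m + 1)) ^ (L - 1))"
    proof (intro prod.cong refl)
      fix m
      have u: "fps_nth (1 - fps_X ^ (m + 1) :: rat fps) 0 \<noteq> 0" by simp
      then have u': "fps_nth ((1 - fps_X ^ (m + 1)) ^ (L - 1) :: rat fps) 0 \<noteq> 0"
        by (simp add: fps_nth_power_0)
      show "(1 / (1 - fps_X ^ (m + 1))) ^ (L - 1) = 1 / (1 - fps_X ^ (m + 1) :: rat fps) ^ (L - 1)"
        by (simp only: fps_divide_unit[OF u] fps_divide_unit[OF u'] mult_1_left fps_inverse_power)
    qed
    finally show ?thesis using fps_monomials[OF W, of n] by simp
  qed
  have "(\<lambda>n. \<Prod>m<n. 1 / (1 - fps_X ^ (m + 1)) ^ (L - 1)) \<longlonglongrightarrow> ?F"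
    unfolding part
  proof (rule tendsto_fpsI)
    fix k
    show "\<forall>\<^sub>F n in sequentially.
        fps_nth (Abs_fps (\<lambda>l. of_nat (card (monomials (W n) l)))) k = fps_nth ?F k"
      using eventually_ge_at_top[of k] by eventually_elim (simp add: stable[symmetric])
  qed
  \<comment> \<open>\<open>has_prod\<close> demands a nonzero limit: at level 0 there is exactly the
    empty monomial. Its partial products run over indices up to and including \<open>n\<close>,
    hence the passage to \<open>Suc n\<close> below.\<close>
  moreover have "fps_nth ?F 0 = 1"
    using stable[of 0 0] by (simp add: W_def monomials_empty)
  then have "?F \<noteq> 0" by (metis fps_zero_nth zero_neq_one)
  ultimately have lim: "(\<lambda>n. \<Prod>m<Suc n. 1 / (1 - fps_X ^ (m + 1)) ^ (L - 1)) \<longlonglongrightarrow> ?F" and nz: "?F \<noteq> 0"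
    by (auto dest: LIMSEQ_Suc)
  have "(\<lambda>m. 1 / (1 - fps_X ^ (m + 1)) ^ (L - 1)) has_prod ?F"
    using lim nz by (simp add: has_prod_def raw_has_prod_def lessThan_Suc_atMost)
  from has_prod_unique[OF this] show "of_nat (card (monomials V l)) = dim_F L l"
    unfolding dim_F_def by (metis fps_nth_Abs_fps)
qed

lemma generators_monomials:
  "finite (monomials (generators L) l)" "of_nat (card (monomials (generators L) l)) = dim_F L l"
  using card_monomials_eq_dim_F[of Gen L l] by (simp_all add: generators_def)

lemma generators_bar_monomials:
  "finite (monomials (generators_bar L) l)" "of_nat (card (monomials (generators_bar L) l)) = dim_F L l"
  using card_monomials_eq_dim_F[of GenBar L l] by (simp_all add: generators_bar_def)

section \<open>Choosing points at which independent functions have a nonzero determinant\<close>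

section \<open>Determinants\<close>

text \<open>The points are chosen one after another. As a function of the last point, the
  determinant is a linear combination of the functions \<open>h t i\<close> with a nonzero
  coefficient, so by independence it cannot vanish on all of \<open>T\<close>.\<close>

lemma exists_det_nonzero:
  fixes h :: "'t \<Rightarrow> nat \<Rightarrow> complex"
  assumes "\<And>c. (\<And>t. t \<in> T \<Longrightarrow> (\<Sum>i<d. c i * h t i) = 0) \<Longrightarrow> \<forall>i<d. c i = 0"
  shows "\<exists>ts. (\<forall>j<d. ts j \<in> T) \<and> det (mat d d (\<lambda>(j, i). h (ts j) i)) \<noteq> 0"
  using assms
proof (induction d)
  case 0
  then show ?case by simp
next
  case (Suc d)
  have "\<exists>ts. (\<forall>j<d. ts j \<in> T) \<and> det (mat d d (\<lambda>(j, i). h (ts j) i)) \<noteq> 0"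
  proof (rule Suc.IH)
    fix c assume c: "\<And>t. t \<in> T \<Longrightarrow> (\<Sum>i<d. c i * h t i) = 0"
    have "\<forall>i<Suc d. (c(d := 0)) i = 0"
      using c by (intro Suc.prems) (simp add: lessThan_Suc)
    then show "\<forall>i<d. c i = 0" by (metis fun_upd_other less_Suc_eq nat_neq_iff)
  qed
  then obtain ts where ts: "\<forall>j<d. ts j \<in> T" "det (mat d d (\<lambda>(j, i). h (ts j) i)) \<noteq> 0"
    by blast
  define M where "M t = mat (Suc d) (Suc d) (\<lambda>(j, i). h ((ts(d := t)) j) i)" for t
  \<comment> \<open>These are the cofactors of the last row. That row is deleted in them, so they do
    not depend on \<open>t\<close>, and \<open>C d\<close> is the nonzero determinant of the
    previous stage.\<close>
  define C where "C i = (-1) ^ (d + i) *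
      det (mat d d (\<lambda>(j, k). h (ts j) (if k < i then k else Suc k)))" for i
  have del: "mat_delete (M t) d i = mat d d (\<lambda>(j, k). h (ts j) (if k < i then k else Suc k))"
    if "i < Suc d" for t i
    using that unfolding mat_delete_def M_def by (intro eq_matI) auto
  have expand: "det (M t) = (\<Sum>i<Suc d. C i * h t i)" for t
  proof -
    have "det (M t) = (\<Sum>i<Suc d. M t $$ (d, i) * cofactor (M t) d i)"
      by (rule laplace_expansion_row) (auto simp: M_def)
    also have "\<dots> = (\<Sum>i<Suc d. C i * h t i)"
      by (intro sum.cong refl) (simp add: cofactor_def del C_def, simp add: M_def)
    finally show ?thesis .
  qed
  have "mat d d (\<lambda>(j, k). h (ts j) (if k < d then k else Suc k)) = mat d d (\<lambda>(j, i). h (ts j) i)"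
    by (intro eq_matI) auto
  then have "C d \<noteq> 0" using ts(2) by (simp add: C_def)
  then obtain t where "t \<in> T" "det (M t) \<noteq> 0"
    using Suc.prems[of C] unfolding expand by blast
  then show ?case using ts(1) unfolding M_def
    by (intro exI[of _ "ts(d := t)"]) (auto simp: less_Suc_eq)
qed

lemma det_nonzero_kernel:
  fixes m :: "nat \<Rightarrow> nat \<Rightarrow> complex"
  assumes "det (mat d d (\<lambda>(j, i). m j i)) \<noteq> 0"
    and "\<And>j. j < d \<Longrightarrow> (\<Sum>i<d. m j i * c i) = 0" and "i < d"
  shows "c i = 0"
proof -
  let ?A = "mat d d (\<lambda>(j, i). m j i)"
  have "?A *\<^sub>v vec d c = 0\<^sub>v d"
    using assms(2) by (intro eq_vecI) (auto simp: scalar_prod_def lessThan_atLeast0)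
  then have "vec d c = 0\<^sub>v d"
    using assms(1) det_0_iff_vec_prod_zero_field[of ?A d] by (metis mat_carrier vec_carrier)
  then show ?thesis using \<open>i < d\<close> by (metis index_vec index_zero_vec(1))
qed

text \<open>With the entries written out in the Leibniz formula, limits and closure properties pass
  through the determinant as through any finite sum of products.\<close>

lemma det_mat:
  "det (mat d d (\<lambda>(j, i). m j i)) =
     (\<Sum>\<pi>\<in>{\<pi>. \<pi> permutes {0..<d}}. signof \<pi> * (\<Prod>j=0..<d. m j (\<pi> j)))"
  unfolding det_def'[OF mat_carrier]
proof (intro sum.cong refl arg_cong2[where f = "(*)"] prod.cong)
  fix \<pi> j assume "\<pi> \<in> {\<pi>. \<pi> permutes {0..<d}}" "j \<in> {0..<d}"
  then have "\<pi> j \<in> {0..<d}" by (metis mem_Collect_eq permutes_in_image)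
  with \<open>j \<in> {0..<d}\<close> show "mat d d (\<lambda>(j, i). m j i) $$ (j, \<pi> j) = m j (\<pi> j)" by simp
qed

section \<open>Finite sums of exponentials of linear forms, and why they are entire\<close>

section \<open>Exponential polynomials on the dual Cartan subalgebra\<close>

inductive exp_poly :: "nat \<Rightarrow> ((nat \<Rightarrow> complex) \<Rightarrow> complex) \<Rightarrow> bool" for L where
  exp_poly_exp: "exp_poly L (\<lambda>a. c * exp (pairing L a v))"
| exp_poly_add: "exp_poly L F \<Longrightarrow> exp_poly L G \<Longrightarrow> exp_poly L (\<lambda>a. F a + G a)"

lemma exp_poly_const: "exp_poly L (\<lambda>a. c)"
  using exp_poly_exp[of L c "\<lambda>_. 0"] by (simp add: pairing_def)

lemma exp_poly_mult:
  assumes "exp_poly L F" "exp_poly L G"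
  shows "exp_poly L (\<lambda>a. F a * G a)"
  using assms(1)
proof induction
  case (exp_poly_exp c v)
  from assms(2) show ?case
  proof induction
    case (exp_poly_exp d w)
    have "(\<lambda>a. c * exp (pairing L a v) * (d * exp (pairing L a w))) =
        (\<lambda>a. (c * d) * exp (pairing L a (\<lambda>s. v s + w s)))"
      by (auto simp: fun_eq_iff pairing_def algebra_simps sum.distrib exp_add)
    then show ?case using exp_poly.exp_poly_exp by metis
  next
    case (exp_poly_add F G)
    then show ?case using exp_poly.exp_poly_add by (simp add: distrib_left)
  qed
next
  case (exp_poly_add F G)
  then show ?case using exp_poly.exp_poly_add by (simp add: distrib_right)
qed

lemma exp_poly_sum:
  assumes "\<And>k. k \<in> K \<Longrightarrow> exp_poly L (F k)"
  shows "exp_poly L (\<lambda>a. \<Sum>k\<in>K. F k a)"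
  using assms
  by (induction K rule: infinite_finite_induct) (auto intro: exp_poly_const exp_poly_add)

lemma exp_poly_prod:
  assumes "\<And>k. k \<in> K \<Longrightarrow> exp_poly L (F k)"
  shows "exp_poly L (\<lambda>a. \<Prod>k\<in>K. F k a)"
  using assms
  by (induction K rule: infinite_finite_induct) (auto intro: exp_poly_const exp_poly_mult)

lemma exp_poly_det:
  assumes "\<And>i j. exp_poly L (\<lambda>a. m a j i)"
  shows "exp_poly L (\<lambda>a. det (mat d d (\<lambda>(j, i). m a j i)))"
  unfolding det_mat using assms
  by (intro exp_poly_sum exp_poly_mult exp_poly_prod exp_poly_const)

lemma pairing_bound: "cmod (pairing L a v) \<le> (\<Sum>s=1..L. cmod (v s)) * hnorm L a"
proof -
  have "cmod (pairing L a v) \<le> (\<Sum>s=1..L. cmod (a s * v s))"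
    unfolding pairing_def by (rule norm_sum)
  also have "\<dots> \<le> (\<Sum>s=1..L. cmod (v s) * hnorm L a)"
  proof (intro sum_mono)
    fix s assume "s \<in> {1..L}"
    then have "cmod (a s) \<le> hnorm L a"
      unfolding hnorm_def by (intro member_le_L2_set) auto
    then show "cmod (a s * v s) \<le> cmod (v s) * hnorm L a"
      by (simp add: norm_mult mult.commute mult_right_mono)
  qed
  finally show ?thesis by (simp add: sum_distrib_right)
qed

lemma hnorm_nonneg: "hnorm L v \<ge> 0"
  by (simp add: hnorm_def)

lemma exp_remainder:
  assumes "e > 0"
  obtains d where "d > 0" "\<And>w::complex. cmod w < d \<Longrightarrow> cmod (exp w - 1 - w) \<le> e * cmod w"
proof -
  have "(exp has_derivative (*) (exp 0)) (at (0::complex))"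
    using DERIV_exp[of "0::complex"] unfolding has_field_derivative_def .
  with assms that show thesis
    unfolding has_derivative_at_alt by force
qed

text \<open>For a single exponential with value E at \<open>a\<close>, the error of the linear
  approximation at \<open>b\<close> is E (exp w - 1 - w) with w the pairing of \<open>b - a\<close>
  with \<open>v\<close>. The exponential remainder at 0 and the bound of w by the norm of
  \<open>b - a\<close> then suffice; sums use e / 2 twice.\<close>

lemma exp_poly_imp_entire:
  assumes "exp_poly L F"
  shows "entire_on_hdual L F"
  using assms
proof induction
  case (exp_poly_exp c v)
  show ?case unfolding entire_on_hdual_def
  proof
    fix a
    define E where "E = c * exp (pairing L a v)"
    \<comment> \<open>The summand 1 keeps \<open>K\<close> positive even when \<open>v\<close>
      vanishes, so that \<open>d / K\<close> makes sense.\<close>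
    define K where "K = 1 + (\<Sum>s=1..L. cmod (v s))"
    have K: "K \<ge> 1" "cmod (pairing L u v) \<le> K * hnorm L u" for u
      using pairing_bound[of L u v] hnorm_nonneg[of L u]
      by (auto simp: K_def sum_nonneg distrib_right)
    show "\<exists>D. (\<forall>u\<in>hdual L. \<forall>v\<in>hdual L. D (u + v) = D u + D v) \<and>
        (\<forall>c. \<forall>v\<in>hdual L. D (\<lambda>s. c * v s) = c * D v) \<and>
        (\<forall>e>0. \<exists>d>0. \<forall>b\<in>hdual L. hnorm L (b - a) < d \<longrightarrow>
          cmod (c * exp (pairing L b v) - c * exp (pairing L a v) - D (b - a)) \<le> e * hnorm L (b - a))"
    proof (intro exI[of _ "\<lambda>u. E * pairing L u v"] conjI ballI allI impI)
      fix u w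
      show "E * pairing L (u + w) v = E * pairing L u v + E * pairing L w v"
        by (simp add: pairing_def algebra_simps sum.distrib)
    next
      fix k u
      show "E * pairing L (\<lambda>s. k * u s) v = k * (E * pairing L u v)"
        by (simp add: pairing_def sum_distrib_left mult_ac)
    next
      fix e :: real assume "e > 0"
      \<comment> \<open>Chosen so that the final bound \<open>(cmod E + 1) * K * e'\<close> is
        exactly \<open>e\<close>; the added 1 avoids division by zero when
        \<open>c = 0\<close>.\<close>
      define e' where "e' = e / ((cmod E + 1) * K)"
      have e': "e' > 0" using \<open>e > 0\<close> K(1) by (auto simp: e'_def intro!: divide_pos_pos mult_pos_pos add_nonneg_pos)
      obtain d where d: "d > 0" "\<And>w::complex. cmod w < d \<Longrightarrow> cmod (exp w - 1 - w) \<le> e' * cmod w"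
        using exp_remainder[OF e'] by blast
      show "\<exists>d>0. \<forall>b\<in>hdual L. hnorm L (b - a) < d \<longrightarrow>
          cmod (c * exp (pairing L b v) - c * exp (pairing L a v) - E * pairing L (b - a) v) \<le> e * hnorm L (b - a)"
      proof (intro exI[of _ "d / K"] conjI ballI impI)
        show "d / K > 0" using d(1) K(1) by simp
      next
        fix b assume b: "hnorm L (b - a) < d / K"
        define w where "w = pairing L (b - a) v"
        have "pairing L b v = pairing L a v + w"
          by (simp add: w_def pairing_def algebra_simps sum_subtractf)
        then have eq: "c * exp (pairing L b v) - c * exp (pairing L a v) - E * w = E * (exp w - 1 - w)"
          by (simp add: E_def exp_add algebra_simps)
        have w: "cmod w \<le> K * hnorm L (b - a)" unfolding w_def by (rule K)
        also have "\<dots> < d" using b K(1) by (simp add: field_simps)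
        finally have "cmod (exp w - 1 - w) \<le> e' * cmod w" by (rule d)
        also have "\<dots> \<le> e' * (K * hnorm L (b - a))" using w e' by (intro mult_left_mono) auto
        finally have "cmod (E * (exp w - 1 - w)) \<le> (cmod E + 1) * (e' * (K * hnorm L (b - a)))"
          unfolding norm_mult by (intro mult_mono) auto
        also have "\<dots> = ((cmod E + 1) * K) * e' * hnorm L (b - a)" by (simp only: mult_ac)
        also have "((cmod E + 1) * K) * e' = e"
        proof -
          have "(cmod E + 1) * K \<noteq> 0" using K(1) norm_ge_zero[of E] by (simp add: add_nonneg_eq_0_iff)
          then show ?thesis by (simp add: e'_def)
        qed
        finally have "cmod (E * (exp w - 1 - w)) \<le> e * hnorm L (b - a)" .
        then show "cmod (c * exp (pairing L b v) - c * exp (pairing L a v) - E * pairing L (b - a) v)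
            \<le> e * hnorm L (b - a)"
          unfolding w_def[symmetric] eq .
      qed
    qed
  qed
next
  case (exp_poly_add F G)
  show ?case unfolding entire_on_hdual_def
  proof
    fix a assume a: "a \<in> hdual L"
    obtain D where D: "\<forall>u\<in>hdual L. \<forall>v\<in>hdual L. D (u + v) = D u + D v"
      "\<forall>c. \<forall>v\<in>hdual L. D (\<lambda>s. c * v s) = c * D v"
      "\<forall>e>0. \<exists>d>0. \<forall>b\<in>hdual L. hnorm L (b - a) < d \<longrightarrow>
           cmod (F b - F a - D (b - a)) \<le> e * hnorm L (b - a)"
      using exp_poly_add.IH(1) a unfolding entire_on_hdual_def by blast
    obtain D' where D': "\<forall>u\<in>hdual L. \<forall>v\<in>hdual L. D' (u + v) = D' u + D' v"
      "\<forall>c. \<forall>v\<in>hdual L. D' (\<lambda>s. c * v s) = c * D' v"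
      "\<forall>e>0. \<exists>d>0. \<forall>b\<in>hdual L. hnorm L (b - a) < d \<longrightarrow>
           cmod (G b - G a - D' (b - a)) \<le> e * hnorm L (b - a)"
      using exp_poly_add.IH(2) a unfolding entire_on_hdual_def by blast
    show "\<exists>D. (\<forall>u\<in>hdual L. \<forall>v\<in>hdual L. D (u + v) = D u + D v) \<and>
        (\<forall>c. \<forall>v\<in>hdual L. D (\<lambda>s. c * v s) = c * D v) \<and>
        (\<forall>e>0. \<exists>d>0. \<forall>b\<in>hdual L. hnorm L (b - a) < d \<longrightarrow>
          cmod (F b + G b - (F a + G a) - D (b - a)) \<le> e * hnorm L (b - a))"
    proof (intro exI[of _ "\<lambda>u. D u + D' u"] conjI allI impI)
      show "\<forall>u\<in>hdual L. \<forall>v\<in>hdual L. D (u + v) + D' (u + v) = D u + D' u + (D v + D' v)"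
        using D(1) D'(1) by simp
      show "\<forall>v\<in>hdual L. D (\<lambda>s. c * v s) + D' (\<lambda>s. c * v s) = c * (D v + D' v)" for c
        using D(2) D'(2) by (simp add: distrib_left)
    next
      fix e :: real assume "e > 0"
      then have "e / 2 > 0" by simp
      then obtain d d' where d: "d > 0" "\<forall>b\<in>hdual L. hnorm L (b - a) < d \<longrightarrow>
           cmod (F b - F a - D (b - a)) \<le> e / 2 * hnorm L (b - a)"
        and d': "d' > 0" "\<forall>b\<in>hdual L. hnorm L (b - a) < d' \<longrightarrow>
           cmod (G b - G a - D' (b - a)) \<le> e / 2 * hnorm L (b - a)"
        using D(3) D'(3) by blast
      show "\<exists>d>0. \<forall>b\<in>hdual L. hnorm L (b - a) < d \<longrightarrow>
          cmod (F b + G b - (F a + G a) - (D (b - a) + D' (b - a))) \<le> e * hnorm L (b - a)"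
      proof (intro exI[of _ "min d d'"] conjI ballI impI)
        fix b assume b: "b \<in> hdual L" "hnorm L (b - a) < min d d'"
        have "cmod (F b + G b - (F a + G a) - (D (b - a) + D' (b - a))) =
            cmod ((F b - F a - D (b - a)) + (G b - G a - D' (b - a)))"
          by (simp add: algebra_simps)
        also have "\<dots> \<le> cmod (F b - F a - D (b - a)) + cmod (G b - G a - D' (b - a))"
          by (rule norm_triangle_ineq)
        also have "\<dots> \<le> e / 2 * hnorm L (b - a) + e / 2 * hnorm L (b - a)"
          using b d d' by (intro add_mono) auto
        finally show "cmod (F b + G b - (F a + G a) - (D (b - a) + D' (b - a))) \<le> e * hnorm L (b - a)"
          by simp
      qed (use d d' in auto)
    qed
  qed
qed

section \<open>From vanishing on sums of vectors to vanishing of all coefficients\<close>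

section \<open>Independence of monomials on sums\<close>

text \<open>A polynomial with infinitely many zeros is zero, and injectivity of the exponents
  prevents different \<open>c v\<close> from merging into one coefficient.\<close>

lemma power_sum_zero:
  fixes c :: "'v \<Rightarrow> complex"
  assumes "finite A" "inj_on n A" "infinite X"
    and "\<And>x. x \<in> X \<Longrightarrow> (\<Sum>v\<in>A. c v * x ^ n v) = 0" and "v \<in> A"
  shows "c v = 0"
proof -
  define P where "P = (\<Sum>v\<in>A. monom (c v) (n v))"
  have "X \<subseteq> {x. poly P x = 0}"
    using assms(4) by (auto simp: P_def poly_sum poly_monom)
  then have "P = 0"
    using assms(3) poly_roots_finite finite_subset by blast
  moreover have "coeff P (n v) = (\<Sum>u\<in>A. if u = v then c u else 0)"
    unfolding P_def coeff_sum using assms(2,5)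
    by (intro sum.cong) (auto simp: inj_on_def)
  ultimately show ?thesis using assms(1,5) by simp
qed

lemma laurent_sum_zero:
  fixes c :: "'v \<Rightarrow> complex" and e :: "'v \<Rightarrow> int"
  assumes "finite A" "inj_on e A" "infinite X" "0 \<notin> X"
    and zero: "\<And>x. x \<in> X \<Longrightarrow> (\<Sum>v\<in>A. c v * x powi e v) = 0" and "v \<in> A"
  shows "c v = 0"
proof -
  \<comment> \<open>Multiplying by x^N clears all negative exponents, since the sum of absolute
    values dominates each of them.\<close>
  define N where "N = (\<Sum>v\<in>A. \<bar>e v\<bar>)"
  have N: "e v + N \<ge> 0" if "v \<in> A" for v
    using member_le_sum[of v A "\<lambda>v. \<bar>e v\<bar>"] that assms(1) by (simp add: N_def)
  show ?thesis
  proof (rule power_sum_zero[of A "\<lambda>v. nat (e v + N)" X c])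
    show "inj_on (\<lambda>v. nat (e v + N)) A"
    proof (rule inj_onI)
      fix u v assume uv: "u \<in> A" "v \<in> A" "nat (e u + N) = nat (e v + N)"
      then have "e u = e v" using N[of u] N[of v] by (simp add: eq_nat_nat_iff)
      then show "u = v" using uv assms(2) by (auto dest: inj_onD)
    qed
  next
    fix x assume x: "x \<in> X"
    have "(\<Sum>v\<in>A. c v * x ^ nat (e v + N)) = (\<Sum>v\<in>A. c v * x powi e v) * x powi N"
      unfolding sum_distrib_right
    proof (intro sum.cong refl)
      fix v assume "v \<in> A"
      then have "x ^ nat (e v + N) = x powi (e v + N)"
        using N by (simp add: power_int_def)
      also have "\<dots> = x powi e v * x powi N"
        using x assms(4) by (intro power_int_add) auto
      finally show "c v * x ^ nat (e v + N) = c v * x powi e v * x powi N" by simp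
    qed
    then show "(\<Sum>v\<in>A. c v * x ^ nat (e v + N)) = 0" using zero[OF x] by simp
  qed (use assms in auto)
qed

text \<open>Freeze all variables but \<open>w\<close>: the sum is a polynomial in the value of
  \<open>w\<close>, so each of its coefficients vanishes. The coefficient at the exponent
  \<open>m b w\<close> involves only the monomials sharing that exponent, which are still distinct
  on the remaining variables.\<close>

lemma monomial_functions_independent:
  fixes c :: "'b \<Rightarrow> complex" and m :: "'b \<Rightarrow> 'v \<Rightarrow> nat"
  assumes "finite V" "finite B"
    and "\<And>b b'. b \<in> B \<Longrightarrow> b' \<in> B \<Longrightarrow> (\<And>v. v \<in> V \<Longrightarrow> m b v = m b' v) \<Longrightarrow> b = b'"
    and "\<And>\<phi>. (\<Sum>b\<in>B. c b * (\<Prod>v\<in>V. \<phi> v ^ m b v)) = 0"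
    and "b \<in> B"
  shows "c b = 0"
  using assms
proof (induction V arbitrary: B b rule: finite_induct)
  case empty
  then have "B = {b}" by auto
  with empty.prems(3) show ?case by simp
next
  case (insert w V)
  define B' where "B' = {b' \<in> B. m b' w = m b w}"
  show ?case
  proof (rule insert.IH[of B'])
    show "finite B'" "b \<in> B'" using insert.prems by (auto simp: B'_def)
  next
    fix b1 b2 assume "b1 \<in> B'" "b2 \<in> B'" "\<And>v. v \<in> V \<Longrightarrow> m b1 v = m b2 v"
    then show "b1 = b2" by (intro insert.prems(2)) (auto simp: B'_def)
  next
    fix \<phi> :: "'v \<Rightarrow> complex"
    define C where "C e = (\<Sum>b'\<in>{b' \<in> B. m b' w = e}. c b' * (\<Prod>v\<in>V. \<phi> v ^ m b' v))" for e
    have "C (m b w) = 0"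
    proof (rule power_sum_zero[of "(\<lambda>b. m b w) ` B" "\<lambda>e. e" UNIV C])
      fix x :: complex
      have "0 = (\<Sum>b\<in>B. c b * (\<Prod>v\<in>insert w V. (\<phi>(w := x)) v ^ m b v))"
        using insert.prems(3) by simp
      also have "\<dots> = (\<Sum>b\<in>B. c b * (\<Prod>v\<in>V. \<phi> v ^ m b v) * x ^ m b w)"
      proof (intro sum.cong refl)
        fix b
        have "(\<Prod>v\<in>V. (\<phi>(w := x)) v ^ m b v) = (\<Prod>v\<in>V. \<phi> v ^ m b v)"
          using insert.hyps by (intro prod.cong) auto
        then show "c b * (\<Prod>v\<in>insert w V. (\<phi>(w := x)) v ^ m b v) = c b * (\<Prod>v\<in>V. \<phi> v ^ m b v) * x ^ m b w"
          using insert.hyps by simp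
      qed
      also have "\<dots> = (\<Sum>e\<in>(\<lambda>b. m b w) ` B. C e * x ^ e)"
        using insert.prems(1)
        by (subst sum.image_gen[where g = "\<lambda>b. m b w"])
           (auto simp: C_def sum_distrib_right intro!: sum.cong)
      finally show "(\<Sum>e\<in>(\<lambda>b. m b w) ` B. C e * x ^ e) = 0" by simp
    qed (use insert.prems in \<open>auto simp: infinite_UNIV_char_0\<close>)
    then show "(\<Sum>b\<in>B'. c b * (\<Prod>v\<in>V. \<phi> v ^ m b v)) = 0"
      by (simp add: C_def B'_def)
  qed
qed

interpretation gen_fun: vector_space "\<lambda>(c::complex) (f :: generator \<Rightarrow> complex) v. c * f v"
  by unfold_locales (auto simp: fun_eq_iff algebra_simps)

text \<open>This is finite-dimensional duality: if no nonzero functional on the coordinates in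
  \<open>V\<close> kills \<open>Z\<close>, then \<open>Z\<close> restricts onto all value
  assignments on \<open>V\<close>. The induction builds a dual basis for the old coordinates and
  then a vector of \<open>Z\<close> supported, within \<open>insert w V\<close>, at \<open>w\<close>
  alone.\<close>

lemma subspace_interpolation:
  assumes "finite V" "gen_fun.subspace Z"
    and "\<And>c. (\<And>z. z \<in> Z \<Longrightarrow> (\<Sum>v\<in>V. c v * z v) = 0) \<Longrightarrow> \<forall>v\<in>V. c v = 0"
  shows "\<exists>z\<in>Z. \<forall>v\<in>V. z v = \<phi> v"
  using assms(1,3)
proof (induction V arbitrary: \<phi> rule: finite_induct)
  case empty
  then show ?case using gen_fun.subspace_0[OF assms(2)] by auto
next
  case (insert w V)
  have IH: "\<exists>z\<in>Z. \<forall>v\<in>V. z v = \<phi> v" for \<phi>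
  proof (rule insert.IH)
    fix c assume c: "\<And>z. z \<in> Z \<Longrightarrow> (\<Sum>v\<in>V. c v * z v) = 0"
    have "(\<Sum>v\<in>V. (c(w := 0)) v * z v) = (\<Sum>v\<in>V. c v * z v)" for z
      using insert.hyps by (intro sum.cong) auto
    then have "\<forall>v\<in>insert w V. (c(w := 0)) v = 0"
      using c insert.hyps by (intro insert.prems) simp
    then show "\<forall>v\<in>V. c v = 0" using insert.hyps by (metis fun_upd_other insertCI)
  qed
  have "\<forall>v. \<exists>z\<in>Z. \<forall>v'\<in>V. z v' = of_bool (v' = v)"
    using IH[of "\<lambda>v'. of_bool (v' = v)" for v] by blast
  then obtain u where u: "\<And>v. u v \<in> Z" "\<And>v v'. v' \<in> V \<Longrightarrow> u v v' = of_bool (v' = v)"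
    by metis
  \<comment> \<open>This functional kills every \<open>u v\<close> with \<open>v\<close> in
    \<open>V\<close> and is nonzero because its entry at \<open>w\<close> is 1. Some
    \<open>t\<close> in \<open>Z\<close> is therefore not killed, and removing its components along
    the \<open>u v\<close> leaves a vector \<open>n\<close> that is zero on \<open>V\<close>, whose
    value at \<open>w\<close> is the value of the functional at \<open>t\<close>.\<close>
  define c where "c = (\<lambda>v. - u v w)(w := 1)"
  have "\<not> (\<forall>z\<in>Z. (\<Sum>v\<in>insert w V. c v * z v) = 0)"
    using insert.prems[of c] by (auto simp: c_def)
  then obtain t where t: "t \<in> Z" "(\<Sum>v\<in>insert w V. c v * t v) \<noteq> 0" by blast
  define n where "n = t - (\<Sum>v\<in>V. (\<lambda>x. t v * u v x))"
  have n_apply: "n x = t x - (\<Sum>v\<in>V. t v * u v x)" for x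
    by (simp add: n_def sum_fun_apply)
  have "n \<in> Z"
    unfolding n_def using assms(2) t u
    by (intro gen_fun.subspace_diff gen_fun.subspace_sum gen_fun.subspace_scale) auto
  have n0: "n x = 0" if "x \<in> V" for x
  proof -
    have "(\<Sum>v\<in>V. t v * u v x) = (\<Sum>v\<in>V. if v = x then t v else 0)"
      using u that by (intro sum.cong) auto
    then show ?thesis using that insert.hyps by (simp add: n_apply)
  qed
  have "(\<Sum>v\<in>V. c v * t v) = (\<Sum>v\<in>V. - (t v * u v w))"
    using insert.hyps by (intro sum.cong) (auto simp: c_def)
  then have "n w \<noteq> 0"
    using t(2) insert.hyps by (simp add: n_apply c_def sum_negf)
  obtain z where z: "z \<in> Z" "\<And>v. v \<in> V \<Longrightarrow> z v = \<phi> v" using IH by blast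
  let ?z = "z + (\<lambda>x. (\<phi> w - z w) / n w * n x)"
  have "?z \<in> Z"
    using assms(2) z \<open>n \<in> Z\<close> by (intro gen_fun.subspace_add gen_fun.subspace_scale)
  moreover have "\<forall>v\<in>insert w V. ?z v = \<phi> v"
    using z n0 \<open>n w \<noteq> 0\<close> by auto
  ultimately show ?case by blast
qed

definition mon_val :: "(generator \<Rightarrow> complex) \<Rightarrow> (generator \<Rightarrow>\<^sub>0 nat) \<Rightarrow> complex" where
  "mon_val \<phi> \<mu> = (\<Prod>v\<in>Poly_Mapping.keys \<mu>. \<phi> v ^ Poly_Mapping.lookup \<mu> v)"

lemma mon_val_superset:
  assumes "finite V" "Poly_Mapping.keys \<mu> \<subseteq> V"
  shows "mon_val \<phi> \<mu> = (\<Prod>v\<in>V. \<phi> v ^ Poly_Mapping.lookup \<mu> v)"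
  unfolding mon_val_def using assms by (intro prod.mono_neutral_left) (auto simp: in_keys_iff)

text \<open>
  A polynomial vanishing on all finite sums of the vectors \<open>\<gamma> t\<close> vanishes on the linear span
  of these vectors: along each direction \<open>\<gamma> t\<close> it is a polynomial in one variable with all
  natural numbers among its zeros.
\<close>

lemma monomials_independent_on_sums:
  fixes \<gamma> :: "'t \<Rightarrow> generator \<Rightarrow> complex"
  assumes "finite V" "finite B" "\<And>\<mu>. \<mu> \<in> B \<Longrightarrow> Poly_Mapping.keys \<mu> \<subseteq> V"
    and ann: "\<And>c. (\<And>t. t \<in> T \<Longrightarrow> (\<Sum>v\<in>V. c v * \<gamma> t v) = 0) \<Longrightarrow> \<forall>v\<in>V. c v = 0"
    and zero: "\<And>ts. set ts \<subseteq> T \<Longrightarrow> (\<Sum>\<mu>\<in>B. c \<mu> * mon_val (\<lambda>v. \<Sum>t\<leftarrow>ts. \<gamma> t v) \<mu>) = 0"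
    and "\<mu> \<in> B"
  shows "c \<mu> = 0"
proof -
  define P where "P \<phi> = (\<Sum>\<mu>\<in>B. c \<mu> * mon_val \<phi> \<mu>)" for \<phi>
  \<comment> \<open>Demanding zeros at all translates by finite sums, and not only at the vector
    itself, is what makes this set stable under adding multiples of
    \<open>\<gamma> t\<close>.\<close>
  define Z where "Z = {\<psi>. \<forall>ts. set ts \<subseteq> T \<longrightarrow> P (\<lambda>v. \<psi> v + (\<Sum>t\<leftarrow>ts. \<gamma> t v)) = 0}"
  have closed: "(\<lambda>v. \<psi> v + s * \<gamma> t v) \<in> Z" if "\<psi> \<in> Z" "t \<in> T" for \<psi> s t
  proof -
    have "P (\<lambda>v. \<psi> v + s * \<gamma> t v + (\<Sum>t\<leftarrow>ts. \<gamma> t v)) = 0" if ts: "set ts \<subseteq> T" for ts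
    proof -
      define Q where "Q = (\<Sum>\<mu>\<in>B. Polynomial.smult (c \<mu>)
        (\<Prod>v\<in>Poly_Mapping.keys \<mu>. [:\<psi> v + (\<Sum>t\<leftarrow>ts. \<gamma> t v), \<gamma> t v:] ^ Poly_Mapping.lookup \<mu> v))"
      have Q: "poly Q s = P (\<lambda>v. \<psi> v + s * \<gamma> t v + (\<Sum>t\<leftarrow>ts. \<gamma> t v))" for s
        by (simp add: Q_def P_def mon_val_def poly_sum poly_prod add_ac)
      have "poly Q (of_nat n) = 0" for n
      proof -
        \<comment> \<open>The parameter value \<open>n\<close> is realised by \<open>n\<close>
          further copies of \<open>t\<close> in the list.\<close>
        have "set (replicate n t @ ts) \<subseteq> T" using ts \<open>t \<in> T\<close> by (auto simp: set_replicate_conv_if)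
        then have "P (\<lambda>v. \<psi> v + (\<Sum>t\<leftarrow>replicate n t @ ts. \<gamma> t v)) = 0"
          using \<open>\<psi> \<in> Z\<close> unfolding Z_def by blast
        then show ?thesis by (simp add: Q sum_list_replicate add.assoc)
      qed
      then have "range of_nat \<subseteq> {x. poly Q x = 0}" by auto
      moreover have "infinite (range (of_nat :: nat \<Rightarrow> complex))"
        by (intro range_inj_infinite) (simp add: inj_on_def)
      ultimately have "Q = 0" using poly_roots_finite finite_subset by blast
      then show ?thesis using Q[of s] by simp
    qed
    then show ?thesis by (simp add: Z_def)
  qed
  have span: "gen_fun.span (\<gamma> ` T) \<subseteq> Z"
  proof
    fix \<psi> assume "\<psi> \<in> gen_fun.span (\<gamma> ` T)"
    then show "\<psi> \<in> Z"
    proof (induction rule: gen_fun.span_induct_alt)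
      case base
      show ?case using zero by (simp add: Z_def P_def)
    next
      case (step s x y)
      then obtain t where "t \<in> T" "x = \<gamma> t" by auto
      with step.IH have "(\<lambda>v. y v + s * x v) \<in> Z" by (simp add: closed)
      then show ?case by (simp add: plus_fun_def add.commute)
    qed
  qed
  have P0: "P \<phi> = 0" for \<phi>
  proof -
    \<comment> \<open>\<open>P\<close> sees only the coordinates in \<open>V\<close>, and on these
      an arbitrary \<open>\<phi>\<close> agrees with some vector of the span.\<close>
    have "\<exists>z\<in>gen_fun.span (\<gamma> ` T). \<forall>v\<in>V. z v = \<phi> v"
    proof (rule subspace_interpolation[OF assms(1) gen_fun.subspace_span])
      fix c assume "\<And>z. z \<in> gen_fun.span (\<gamma> ` T) \<Longrightarrow> (\<Sum>v\<in>V. c v * z v) = 0"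
      then show "\<forall>v\<in>V. c v = 0" by (intro ann) (auto intro: gen_fun.span_base)
    qed
    then obtain z where z: "z \<in> Z" "\<forall>v\<in>V. z v = \<phi> v" using span by blast
    have "P z = 0"
      using z(1) unfolding Z_def by (auto dest: spec[of _ "[]"])
    moreover have "mon_val z \<mu> = mon_val \<phi> \<mu>" if "\<mu> \<in> B" for \<mu>
      unfolding mon_val_def using z(2) assms(3)[OF that] by (intro prod.cong) auto
    ultimately show ?thesis by (simp add: P_def)
  qed
  show ?thesis
  proof (rule monomial_functions_independent[of V B Poly_Mapping.lookup c])
    fix \<mu> \<nu> assume *: "\<mu> \<in> B" "\<nu> \<in> B" "\<And>v. v \<in> V \<Longrightarrow> Poly_Mapping.lookup \<mu> v = Poly_Mapping.lookup \<nu> v"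
    show "\<mu> = \<nu>"
    proof (rule poly_mapping_eqI)
      fix v show "Poly_Mapping.lookup \<mu> v = Poly_Mapping.lookup \<nu> v"
      proof (cases "v \<in> V")
        case False
        then have "v \<notin> Poly_Mapping.keys \<mu>" "v \<notin> Poly_Mapping.keys \<nu>"
          using * assms(3) by auto
        then show ?thesis by (simp add: in_keys_iff)
      qed (use * in simp)
    qed
  next
    fix \<phi> :: "generator \<Rightarrow> complex"
    show "(\<Sum>\<mu>\<in>B. c \<mu> * (\<Prod>v\<in>V. \<phi> v ^ Poly_Mapping.lookup \<mu> v)) = 0"
      using P0[of \<phi>] assms(1,3) unfolding P_def by (simp add: mon_val_superset cong: sum.cong)
  qed (use assms in auto)
qed

section \<open>Generator values on the tuple of initial segments\<close>

section \<open>The dominant term\<close>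

lemma omega_pow_add: "omega_pow L (c + d) = omega_pow L c * omega_pow L d"
  by (simp add: omega_pow_def exp_add[symmetric] add_divide_distrib distrib_left)

lemma omega_pow_nonzero: "omega_pow L c \<noteq> 0"
  by (simp add: omega_pow_def)

lemma omega_pow_power: "omega_pow L c ^ m = omega_pow L (c * of_nat m)"
  by (simp add: omega_pow_def exp_of_nat_mult[symmetric] mult_ac)

lemma omega_pow_minus: "omega_pow L (- c) = inverse (omega_pow L c)"
  by (simp add: omega_pow_def exp_minus)

lemma norm_omega_pow: "Im c = 0 \<Longrightarrow> cmod (omega_pow L c) = 1"
  by (simp add: omega_pow_def norm_exp_eq_Re)

text \<open>
  The value of a generator at a single particle of kind \<open>k\<close> when \<open>S = {1..k}\<close>: all but one
  of the \<open>k\<close> terms cancel.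
\<close>

primrec top_val :: "nat \<Rightarrow> nat \<Rightarrow> complex \<Rightarrow> generator \<Rightarrow> complex" where
  "top_val L k x (Gen i m) =
     (if k = i then omega_pow L ((of_nat k - of_nat L) / 2 * of_nat m) * x ^ m else 0)"
| "top_val L k x (GenBar i m) =
     (if k + i = L then - (omega_pow L ((of_nat L - of_nat k) / 2 * of_nat m) * x powi (- int m)) else 0)"

definition top_tuple :: "nat list \<Rightarrow> nat set list" where
  "top_tuple ks = map (\<lambda>k. {1..k}) ks"

lemma elt_atLeastAtMost: "j \<in> {1..k} \<Longrightarrow> elt {1..k} j = j"
proof -
  assume j: "j \<in> {1..k}"
  have "sorted_list_of_set {1..k} = [1..<Suc k]"
    by (metis atLeastLessThanSuc_atLeastAtMost sorted_list_of_set_range)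
  then show ?thesis using j by (simp add: elt_def del: upt_Suc)
qed

text \<open>When the j-th element of the subset is \<open>j\<close> itself, the phase attached to
  the weight and the phase inside \<open>y_val\<close> combine to one independent of
  \<open>j\<close>. What remains is the sum of the pairings of \<open>alpha L i\<close> with the
  first \<open>k\<close> weights (reflected ones in the barred case), which telescopes to a single
  boundary term.\<close>

lemma E_gen_top:
  assumes ks: "set ks \<subseteq> {1..L - 1}" and len: "length xs = length ks"
    and v: "v \<in> generators L \<union> generators_bar L"
  shows "E_gen L ks (top_tuple ks) xs v = (\<Sum>n<length ks. top_val L (ks ! n) (xs ! n) v)"
proof (cases v)
  case (Gen i m)
  with v have i: "1 \<le> i" "i < L" by (auto simp: generators_def generators_bar_def)
  have "(\<Sum>j=1..ks ! n. let s = elt (top_tuple ks ! n) j in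
        pairing L (alpha L i) (weightH L s)
        * omega_pow L (- ((of_nat L + 1 - 2 * of_nat s) / 2) * of_nat m)
        * y_val L ks xs n j ^ m) = top_val L (ks ! n) (xs ! n) v" if n: "n < length ks" for n
  proof -
    define k where "k = ks ! n"
    have "k \<in> {1..L - 1}" using nth_mem[OF n] ks by (auto simp: k_def)
    then have k: "1 \<le> k" "k < L" using i by auto
    have "(\<Sum>j=1..k. let s = elt (top_tuple ks ! n) j in
        pairing L (alpha L i) (weightH L s)
        * omega_pow L (- ((of_nat L + 1 - 2 * of_nat s) / 2) * of_nat m)
        * y_val L ks xs n j ^ m) =
      (\<Sum>j=1..k. (of_bool (i = j) - of_bool (Suc i = j)) *
         (omega_pow L ((of_nat k - of_nat L) / 2 * of_nat m) * (xs ! n) ^ m))"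
    proof (intro sum.cong refl)
      fix j assume j: "j \<in> {1..k}"
      have top: "elt (top_tuple ks ! n) j = j"
        using n elt_atLeastAtMost[OF j] by (simp add: top_tuple_def k_def)
      have "omega_pow L (- ((of_nat L + 1 - 2 * of_nat j) / 2) * of_nat m) * y_val L ks xs n j ^ m =
          omega_pow L (- ((of_nat L + 1 - 2 * of_nat j) / 2) * of_nat m
            + (of_nat k + 1 - 2 * of_nat j) / 2 * of_nat m) * (xs ! n) ^ m"
        unfolding y_val_def power_mult_distrib omega_pow_power omega_pow_add k_def by (simp only: mult_ac)
      also have "- ((of_nat L + 1 - 2 * of_nat j) / 2) * of_nat m
            + (of_nat k + 1 - 2 * of_nat j) / 2 * of_nat m = (of_nat k - of_nat L) / 2 * (of_nat m :: complex)"
        by (simp add: field_simps)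
      finally show "(let s = elt (top_tuple ks ! n) j in
        pairing L (alpha L i) (weightH L s)
        * omega_pow L (- ((of_nat L + 1 - 2 * of_nat s) / 2) * of_nat m)
        * y_val L ks xs n j ^ m) = (of_bool (i = j) - of_bool (Suc i = j)) *
         (omega_pow L ((of_nat k - of_nat L) / 2 * of_nat m) * (xs ! n) ^ m)"
        using pairing_alpha_weightH[of i L j] i j k unfolding Let_def top by (simp add: mult.assoc)
    qed
    also have "\<dots> = (of_bool (i \<le> k) - of_bool (Suc i \<le> k)) *
         (omega_pow L ((of_nat k - of_nat L) / 2 * of_nat m) * (xs ! n) ^ m)"
      using i unfolding sum_distrib_right[symmetric] sum_subtractf
      by (simp add: of_bool_def sum.delta)
    finally show ?thesis using Gen by (simp add: k_def of_bool_def)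
  qed
  then show ?thesis by (simp add: Gen)
next
  case (GenBar i m)
  with v have i: "1 \<le> i" "i < L" by (auto simp: generators_def generators_bar_def)
  have "(\<Sum>j=1..ks ! n. let s = elt (top_tuple ks ! n) j in
        pairing L (alpha L i) (weightH L (L + 1 - s))
        * omega_pow L ((of_nat L + 1 - 2 * of_nat s) / 2 * of_nat m)
        * y_val L ks xs n j powi (- int m)) = top_val L (ks ! n) (xs ! n) v" if n: "n < length ks" for n
  proof -
    define k where "k = ks ! n"
    have "k \<in> {1..L - 1}" using nth_mem[OF n] ks by (auto simp: k_def)
    then have k: "1 \<le> k" "k < L" using i by auto
    have "(\<Sum>j=1..k. let s = elt (top_tuple ks ! n) j in
        pairing L (alpha L i) (weightH L (L + 1 - s))
        * omega_pow L ((of_nat L + 1 - 2 * of_nat s) / 2 * of_nat m)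
        * y_val L ks xs n j powi (- int m)) =
      (\<Sum>j=1..k. (of_bool (L + 1 - i = j) - of_bool (L - i = j)) *
         (omega_pow L ((of_nat L - of_nat k) / 2 * of_nat m) * (xs ! n) powi (- int m)))"
    proof (intro sum.cong refl)
      fix j assume j: "j \<in> {1..k}"
      have top: "elt (top_tuple ks ! n) j = j"
        using n elt_atLeastAtMost[OF j] by (simp add: top_tuple_def k_def)
      have "omega_pow L ((of_nat L + 1 - 2 * of_nat j) / 2 * of_nat m) * y_val L ks xs n j powi (- int m) =
          omega_pow L ((of_nat L + 1 - 2 * of_nat j) / 2 * of_nat m
            + - ((of_nat k + 1 - 2 * of_nat j) / 2 * of_nat m)) * (xs ! n) powi (- int m)"
        unfolding omega_pow_add omega_pow_minus omega_pow_power[symmetric]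
        by (simp only: y_val_def power_int_minus power_int_of_nat power_mult_distrib k_def
              inverse_mult_distrib mult_ac)
      also have "(of_nat L + 1 - 2 * of_nat j) / 2 * of_nat m
            + - ((of_nat k + 1 - 2 * of_nat j) / 2 * of_nat m) = (of_nat L - of_nat k) / 2 * (of_nat m :: complex)"
        by (simp add: field_simps)
      finally have *: "omega_pow L ((of_nat L + 1 - 2 * of_nat j) / 2 * of_nat m) * y_val L ks xs n j powi (- int m) =
        omega_pow L ((of_nat L - of_nat k) / 2 * of_nat m) * (xs ! n) powi (- int m)" .
      \<comment> \<open>The reflection reverses the order of the two nonzero pairings: -1 comes at
        \<open>j = L - i\<close> and +1 only after it. This is the source of the minus sign and of
        the condition \<open>k + i = L\<close> in \<open>top_val\<close>.\<close>
      have "pairing L (alpha L i) (weightH L (L + 1 - j)) = of_bool (i = L + 1 - j) - of_bool (Suc i = L + 1 - j)"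
        using i j k by (intro pairing_alpha_weightH) auto
      also have "\<dots> = of_bool (L + 1 - i = j) - of_bool (L - i = j)"
        using i j k by (intro arg_cong2[where f = "(-)"] arg_cong[where f = of_bool]) auto
      finally show "(let s = elt (top_tuple ks ! n) j in
        pairing L (alpha L i) (weightH L (L + 1 - s))
        * omega_pow L ((of_nat L + 1 - 2 * of_nat s) / 2 * of_nat m)
        * y_val L ks xs n j powi (- int m)) = (of_bool (L + 1 - i = j) - of_bool (L - i = j)) *
         (omega_pow L ((of_nat L - of_nat k) / 2 * of_nat m) * (xs ! n) powi (- int m))"
        using * unfolding Let_def top by (simp only: mult.assoc)
    qed
    also have "\<dots> = (of_bool (L + 1 - i \<le> k) - of_bool (L - i \<le> k)) *
         (omega_pow L ((of_nat L - of_nat k) / 2 * of_nat m) * (xs ! n) powi (- int m))"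
      using i unfolding sum_distrib_right[symmetric] sum_subtractf
      by (auto simp: of_bool_def sum.delta)
    also have "of_bool (L + 1 - i \<le> k) - of_bool (L - i \<le> k) = (if k + i = L then - 1 else 0 :: complex)"
      using i k by (auto simp: of_bool_def)
    finally show ?thesis using GenBar by (simp add: k_def)
  qed
  then show ?thesis by (simp add: GenBar)
qed

text \<open>A particle of kind \<open>k\<close> sees only the generators belonging to that kind, and
  on them the sum is a Laurent polynomial in the exponential of the rapidity. Unbarred generators
  have exponent m and barred ones -m with m at least 1, so kind and exponent together determine the
  generator and no exponents coincide.\<close>

lemma top_val_no_annihilator:
  assumes "finite V" "V \<subseteq> generators L \<union> generators_bar L"
    and zero: "\<And>k \<theta>::real. k \<in> {1..L - 1} \<Longrightarrow> (\<Sum>v\<in>V. c v * top_val L k (exp (of_real \<theta>)) v) = 0"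
    and "v \<in> V"
  shows "c v = 0"
proof -
  define kind where "kind v = (case v of Gen i m \<Rightarrow> i | GenBar i m \<Rightarrow> L - i)" for v
  define e where "e v = (case v of Gen i m \<Rightarrow> int m | GenBar i m \<Rightarrow> - int m)" for v
  define coef where "coef v = top_val L (kind v) 1 v" for v
  have gen: "kind v \<in> {1..L - 1}" "coef v \<noteq> 0"
    "top_val L k x v = (if kind v = k then coef v * x powi e v else 0)" if "v \<in> V" for v k x
  proof -
    from that assms(2) have "v \<in> generators L \<union> generators_bar L" by auto
    then show "kind v \<in> {1..L - 1}" "coef v \<noteq> 0"
      "top_val L k x v = (if kind v = k then coef v * x powi e v else 0)"
      by (auto simp: generators_def generators_bar_def kind_def e_def coef_def omega_pow_nonzero)
  qed
  define A where "A = {u \<in> V. kind u = kind v}"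
  have "c v * coef v = 0"
  proof (rule laurent_sum_zero[of A e "range (\<lambda>\<theta>::real. exp (of_real \<theta>))" "\<lambda>v. c v * coef v"])
    show "finite A" "v \<in> A" using assms by (auto simp: A_def)
    show "inj_on e A"
    proof (rule inj_onI)
      fix u w assume uw: "u \<in> A" "w \<in> A" "e u = e w"
      then have "u \<in> generators L \<union> generators_bar L" "w \<in> generators L \<union> generators_bar L" "kind u = kind w"
        using assms(2) by (auto simp: A_def)
      with uw(3) show "u = w"
        by (auto simp: generators_def generators_bar_def kind_def e_def)
    qed
    show "infinite (range (\<lambda>\<theta>::real. exp (of_real \<theta>) :: complex))"
    proof -
      have "inj (\<lambda>\<theta>::real. exp (of_real \<theta>) :: complex)"
        by (auto simp: inj_on_def exp_of_real)
      then show ?thesis using finite_imageD infinite_UNIV_char_0 by blast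
    qed
    show "0 \<notin> range (\<lambda>\<theta>::real. exp (of_real \<theta>) :: complex)" by auto
  next
    fix x :: complex assume "x \<in> range (\<lambda>\<theta>::real. exp (of_real \<theta>))"
    then obtain \<theta> :: real where x: "x = exp (of_real \<theta>)" by auto
    have "(\<Sum>u\<in>A. c u * coef u * x powi e u) = (\<Sum>u\<in>V. c u * top_val L (kind v) x u)"
      unfolding A_def using assms(1)
      by (simp add: gen(3) sum.inter_filter[symmetric] if_distrib mult_ac cong: if_cong sum.cong)
    also have "\<dots> = 0" unfolding x using gen(1)[OF assms(4)] by (rule zero)
    finally show "(\<Sum>u\<in>A. c u * coef u * x powi e u) = 0" .
  qed
  then show ?thesis using gen(2)[OF assms(4)] by simp
qed

section \<open>Growth of the terms of \<open>J_fun\<close> along a ray in the parameter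
  space\<close>

section \<open>Isolating the dominant term\<close>

text \<open>The elements of \<open>S\<close> outside the interval exceed \<open>k\<close>, the
  elements of the interval missing from \<open>S\<close> are at most \<open>k\<close>, and there are
  equally many of both.\<close>

lemma sum_interval_less:
  fixes S :: "nat set"
  assumes "finite S" "0 \<notin> S" "card S = k" "S \<noteq> {1..k}"
  shows "\<Sum>{1..k} < \<Sum>S"
proof -
  let ?A = "S - {1..k}" and ?B = "{1..k} - S"
  have "card ?A + card (S \<inter> {1..k}) = card S"
    using assms(1) card_Diff_subset_Int[of S "{1..k}"] card_mono[of S "S \<inter> {1..k}"] by simp
  moreover have "card ?B + card (S \<inter> {1..k}) = k"
    using card_Diff_subset_Int[of "{1..k}" S] card_mono[of "{1..k}" "S \<inter> {1..k}"] by (simp add: Int_commute)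
  ultimately have AB: "card ?A = card ?B" using assms(3) by simp
  have "?A \<noteq> {}"
  proof
    assume "?A = {}"
    then have "S = {1..k}" using assms(3) by (intro card_subset_eq) auto
    with assms(4) show False by simp
  qed
  then have pos: "card ?A > 0" using assms(1) by (simp add: card_gt_0_iff)
  have "\<Sum>?B \<le> card ?B * k"
    using sum_bounded_above[of ?B "\<lambda>x. x" k] by simp
  also have "\<dots> < card ?A * (k + 1)" using AB pos by simp
  also have "\<dots> \<le> \<Sum>?A"
    using sum_bounded_below[of ?A "k + 1" "\<lambda>x. x"] assms(2) by (force simp: not_le)
  finally have "\<Sum>?B + \<Sum>(S \<inter> {1..k}) < \<Sum>?A + \<Sum>(S \<inter> {1..k})" by simp
  moreover have "\<Sum>?B + \<Sum>(S \<inter> {1..k}) = \<Sum>{1..k}"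
    using sum.Int_Diff[of "{1..k}" "\<lambda>x. x" S] by (simp add: Int_commute)
  moreover have "\<Sum>?A + \<Sum>(S \<inter> {1..k}) = \<Sum>S"
    using sum.Int_Diff[OF assms(1), of "\<lambda>x. x" "{1..k}"] by simp
  ultimately show ?thesis by simp
qed

lemma finite_subset_tuples: "finite (subset_tuples L ks)"
proof (rule finite_subset)
  show "subset_tuples L ks \<subseteq> {Ss. set Ss \<subseteq> Pow {1..L} \<and> length Ss = length ks}"
    by (force simp: subset_tuples_def in_set_conv_nth)
  show "finite {Ss. set Ss \<subseteq> Pow {1..L} \<and> length Ss = length ks}"
    by (intro finite_lists_length_eq) auto
qed

text \<open>The constant part -1/L of each weight pairs to zero because the coordinates of
  \<open>a\<close> sum to zero.\<close>

lemma pairing_weightHset: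
  assumes "a \<in> hdual L" "S \<subseteq> {1..L}"
  shows "pairing L a (weightHset L S) = (\<Sum>s\<in>S. a s)"
proof -
  have "pairing L a (weightHset L S) = (\<Sum>s\<in>S. \<Sum>t=1..L. a t * weightH L s t)"
    unfolding pairing_def weightHset_def sum_fun_apply sum_distrib_left by (rule sum.swap)
  also have "\<dots> = (\<Sum>s\<in>S. a s)"
  proof (intro sum.cong refl)
    fix s assume "s \<in> S"
    then have s: "s \<in> {1..L}" using assms(2) by auto
    have "(\<Sum>t=1..L. a t * weightH L s t) = (\<Sum>t=1..L. of_bool (t = s) * a t - a t * (1 / of_nat L))"
      by (intro sum.cong) (auto simp: weightH_def algebra_simps)
    also have "\<dots> = a s"
      using s assms(1) unfolding sum_subtractf sum_of_bool_times sum_distrib_right[symmetric]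
      by (simp add: hdual_def)
    finally show "(\<Sum>t=1..L. a t * weightH L s t) = a s" .
  qed
  finally show ?thesis .
qed

lemma pairing_sum_right: "pairing L a (\<Sum>n\<in>A. v n) = (\<Sum>n\<in>A. pairing L a (v n))"
  unfolding pairing_def sum_fun_apply sum_distrib_left by (rule sum.swap)

text \<open>The Weyl vector of the root system: its pairing with every simple root is 1, so it is
  strictly dominant.\<close>

definition rho :: "nat \<Rightarrow> nat \<Rightarrow> real" where
  "rho L s = (if s \<in> {1..L} then (real L + 1) / 2 - real s else 0)"

text \<open>The prefactor cancels the one in the exponent of \<open>omega_pow\<close>, so along the
  ray the characters become real exponentials in \<open>t\<close>.\<close>

definition ray :: "nat \<Rightarrow> real \<Rightarrow> nat \<Rightarrow> complex" where
  "ray L t = (\<lambda>s. of_nat L / (2 * of_real pi * \<i>) * of_real (t * rho L s))"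

lemma ray_in_hdual: "ray L t \<in> hdual L"
proof -
  have "(\<Sum>s=1..L. rho L s) = (\<Sum>s=1..L. (real L + 1) / 2 - real s)"
    by (intro sum.cong) (auto simp: rho_def)
  also have "\<dots> = real L * (real L + 1) / 2 - real (\<Sum>s=1..L. s)"
    by (simp add: sum_subtractf)
  also have "real (\<Sum>s=1..L. s) = real L * (real L + 1) / 2"
    using gauss_sum_from_Suc_0[of L, where 'a = nat] by (simp add: real_of_nat_div field_simps)
  finally have "(\<Sum>s=1..L. rho L s) = 0" by simp
  then have "(\<Sum>s=1..L. ray L t s) = 0"
    unfolding ray_def sum_distrib_left[symmetric] of_real_sum[symmetric] by simp
  then show ?thesis by (auto simp: hdual_def ray_def rho_def)
qed

text \<open>The exponential growth rate in \<open>t\<close> of the term of \<open>J_fun\<close>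
  belonging to the tuple.\<close>

definition height :: "nat \<Rightarrow> nat set list \<Rightarrow> real" where
  "height L Ss = (\<Sum>n<length Ss. \<Sum>s\<in>Ss ! n. rho L s)"

lemma omega_pow_ray:
  assumes "L > 0" "Ss \<in> subset_tuples L ks"
  shows "omega_pow L (pairing L (ray L t) (\<Sum>n<length ks. weightHset L (Ss ! n))) =
    of_real (exp (t * height L Ss))"
proof -
  have "pairing L (ray L t) (\<Sum>n<length ks. weightHset L (Ss ! n)) =
      (\<Sum>n<length ks. \<Sum>s\<in>Ss ! n. ray L t s)"
    unfolding pairing_sum_right using assms(2)
    by (intro sum.cong refl pairing_weightHset ray_in_hdual) (auto simp: subset_tuples_def)
  also have "\<dots> = of_nat L / (2 * of_real pi * \<i>) * of_real (t * height L Ss)"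
    using assms(2) unfolding ray_def height_def
    by (simp add: sum_distrib_left subset_tuples_def)
  finally have *: "pairing L (ray L t) (\<Sum>n<length ks. weightHset L (Ss ! n)) =
    of_nat L / (2 * of_real pi * \<i>) * of_real (t * height L Ss)" .
  show ?thesis
    unfolding * omega_pow_def exp_of_real[symmetric] using assms(1)
    by (simp add: field_simps)
qed

lemma top_tuple_in_subset_tuples:
  assumes "set ks \<subseteq> {1..L - 1}"
  shows "top_tuple ks \<in> subset_tuples L ks"
  using assms unfolding subset_tuples_def top_tuple_def
  by (auto simp: subset_iff dest!: nth_mem)

text \<open>For subsets of fixed size the sum of \<open>rho\<close> is a constant minus the sum of
  the elements, so each entry is maximised exactly by the initial segment; a different tuple is
  strictly worse in at least one entry.\<close>

lemma height_less:
  assumes "Ss \<in> subset_tuples L ks" "Ss \<noteq> top_tuple ks" "set ks \<subseteq> {1..L - 1}"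
  shows "height L Ss < height L (top_tuple ks)"
proof -
  have len: "length Ss = length ks" "length (top_tuple ks) = length ks"
    using assms(1) by (auto simp: subset_tuples_def top_tuple_def)
  have S: "Ss ! n \<subseteq> {1..L}" "card (Ss ! n) = ks ! n" "finite (Ss ! n)" "ks ! n \<le> L"
    "top_tuple ks ! n = {1..ks ! n}" if "n < length ks" for n
  proof -
    show S: "Ss ! n \<subseteq> {1..L}" "card (Ss ! n) = ks ! n"
      using that assms(1) by (auto simp: subset_tuples_def)
    then show "finite (Ss ! n)" by (auto intro: finite_subset)
    show "ks ! n \<le> L" using card_mono[OF _ S(1)] S(2) by simp
    show "top_tuple ks ! n = {1..ks ! n}" using that by (simp add: top_tuple_def)
  qed
  have eq: "(\<Sum>s\<in>A. rho L s) = real (card A) * ((real L + 1) / 2) - real (\<Sum>A)" if "A \<subseteq> {1..L}" for A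
  proof -
    have "(\<Sum>s\<in>A. rho L s) = (\<Sum>s\<in>A. (real L + 1) / 2 - real s)"
      using that by (intro sum.cong) (auto simp: rho_def)
    then show ?thesis by (simp add: sum_subtractf)
  qed
  have less: "(\<Sum>s\<in>Ss ! n. rho L s) < (\<Sum>s\<in>top_tuple ks ! n. rho L s)"
    if n: "n < length ks" and ne: "Ss ! n \<noteq> top_tuple ks ! n" for n
  proof -
    have "0 \<notin> Ss ! n" using S(1)[OF n] by auto
    then have "\<Sum>{1..ks ! n} < \<Sum>(Ss ! n)"
      using S[OF n] ne by (intro sum_interval_less) auto
    moreover have "{1..ks ! n} \<subseteq> {1..L}" using S(4)[OF n] by auto
    ultimately show ?thesis
      using S[OF n] by (simp add: eq del: of_nat_sum)
  qed
  obtain n where n: "n < length ks" "Ss ! n \<noteq> top_tuple ks ! n"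
    using assms(2) len by (metis nth_equalityI)
  show ?thesis unfolding height_def len
  proof (rule sum_strict_mono_ex1)
    show "\<forall>n\<in>{..<length ks}. (\<Sum>s\<in>Ss ! n. rho L s) \<le> (\<Sum>s\<in>top_tuple ks ! n. rho L s)"
      using less by (metis lessThan_iff order_le_less)
    show "\<exists>n\<in>{..<length ks}. (\<Sum>s\<in>Ss ! n. rho L s) < (\<Sum>s\<in>top_tuple ks ! n. rho L s)"
      using less n by auto
  qed simp
qed

text \<open>Along the ray every tuple contributes an exponential in \<open>t\<close> times a
  constant. After division by the largest exponential all terms but that of \<open>top_tuple\<close>
  decay, by \<open>height_less\<close>.\<close>

lemma J_fun_limit:
  assumes "L \<ge> 2" "set ks \<subseteq> {1..L - 1}"
  shows "((\<lambda>t. of_real (exp (- t * height L (top_tuple ks))) * J_fun L p (ray L t) g ks xs)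
    \<longlongrightarrow> Phi L p ks (top_tuple ks) xs * E_hom L ks (top_tuple ks) xs g) at_top"
proof -
  let ?T = "top_tuple ks" and ?S = "subset_tuples L ks"
  let ?w = "\<lambda>Ss. Phi L p ks Ss xs * E_hom L ks Ss xs g"
  have "of_real (exp (- t * height L ?T)) * J_fun L p (ray L t) g ks xs =
      (\<Sum>Ss\<in>?S. of_real (exp (t * (height L Ss - height L ?T))) * ?w Ss)" for t
    unfolding J_fun_def sum_distrib_left
  proof (intro sum.cong refl)
    fix Ss assume "Ss \<in> ?S"
    then have w: "omega_pow L (pairing L (ray L t) (\<Sum>n<length ks. weightHset L (Ss ! n))) =
        of_real (exp (t * height L Ss))"
      using assms(1) by (intro omega_pow_ray) auto
    have "exp (t * (height L Ss - height L ?T)) = exp (- t * height L ?T) * exp (t * height L Ss)"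
      by (simp add: exp_add[symmetric] algebra_simps)
    then show "of_real (exp (- t * height L ?T)) *
        (omega_pow L (pairing L (ray L t) (\<Sum>n<length ks. weightHset L (Ss ! n))) *
          Phi L p ks Ss xs * E_hom L ks Ss xs g) =
      of_real (exp (t * (height L Ss - height L ?T))) * ?w Ss"
      unfolding w by simp
  qed
  moreover have "((\<lambda>t. \<Sum>Ss\<in>?S. of_real (exp (t * (height L Ss - height L ?T))) * ?w Ss)
      \<longlongrightarrow> (\<Sum>Ss\<in>?S. (if Ss = ?T then ?w Ss else 0))) at_top"
  proof (intro tendsto_sum)
    fix Ss assume Ss: "Ss \<in> ?S"
    show "((\<lambda>t. of_real (exp (t * (height L Ss - height L ?T))) * ?w Ss)
        \<longlongrightarrow> (if Ss = ?T then ?w Ss else 0)) at_top"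
    proof (cases "Ss = ?T")
      case False
      then have "height L Ss - height L ?T < 0"
        using height_less[OF Ss _ assms(2)] by simp
      then have "filterlim (\<lambda>t. (height L Ss - height L ?T) * t) at_bot at_top"
        by (rule filterlim_tendsto_neg_mult_at_bot[OF tendsto_const _ filterlim_ident])
      then have "((\<lambda>t. exp ((height L Ss - height L ?T) * t)) \<longlongrightarrow> 0) at_top"
        by (rule filterlim_compose[OF exp_at_bot])
      then have "((\<lambda>t. exp (t * (height L Ss - height L ?T))) \<longlongrightarrow> 0) at_top"
        by (simp only: mult.commute)
      then have "((\<lambda>t. complex_of_real (exp (t * (height L Ss - height L ?T))) * ?w Ss) \<longlongrightarrow> of_real 0 * ?w Ss) at_top"
        by (intro tendsto_mult tendsto_of_real tendsto_const)
      with False show ?thesis by simp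
    qed simp
  qed
  ultimately show ?thesis
    using top_tuple_in_subset_tuples[OF assms(2)] finite_subset_tuples[of L ks] by simp
qed

text \<open>The parameter \<open>a\<close> enters only through the characters; \<open>Phi\<close>
  and \<open>E_hom\<close> are constants in it.\<close>

lemma exp_poly_J_fun: "exp_poly L (\<lambda>a. J_fun L p a g ks xs)"
proof -
  have "omega_pow L (pairing L a v) = exp (pairing L a (\<lambda>s. 2 * of_real pi * \<i> / of_nat L * v s))" for a v
    unfolding omega_pow_def pairing_def
    by (simp add: sum_distrib_left sum_divide_distrib mult_ac)
  then have "exp_poly L (\<lambda>a. omega_pow L (pairing L a v))" for v
    using exp_poly_exp[of L 1] by simp
  then show ?thesis unfolding J_fun_def
    by (intro exp_poly_sum exp_poly_mult exp_poly_const)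
qed

section \<open>Real rapidities at which no factor of a form factor is singular or zero\<close>

section \<open>Regular configurations of real rapidities\<close>

text \<open>Zeros of \<open>R\<close> are excluded along with its singularities, so that a vanishing
  form factor forces \<open>J_fun\<close> to vanish. The element 0 keeps rapidities with differences
  outside the set pairwise distinct.\<close>

definition singular_shifts :: "nat \<Rightarrow> (complex \<Rightarrow> complex) \<Rightarrow> real set" where
  "singular_shifts L R = insert 0 (\<Union>k\<in>{..L}. \<Union>l\<in>{..L}. \<Union>r\<in>{..L}. \<Union>j\<in>{..L}.
     {t. let z = of_real t + R_shift L k l r j in \<not> R analytic_on {z} \<or> R z = 0})"

lemma R_integral_nonzero: "R_integral L p \<theta> \<noteq> 0"
  by (simp add: R_integral_def)

lemma countable_singular_shifts:
  assumes "is_R_continuation L p R"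
  shows "countable (singular_shifts L R)"
proof -
  let ?Bad = "{z. \<not> (R analytic_on {z} \<and> R z \<noteq> 0)}"
  have nice: "R nicely_meromorphic_on UNIV"
    and strip: "\<And>\<theta>. - 2 * pi < Im \<theta> \<Longrightarrow> Im \<theta> < 0 \<Longrightarrow> R \<theta> = R_integral L p \<theta>"
    using assms by (auto simp: is_R_continuation_def)
  have "eventually (\<lambda>z. R analytic_on {z}) (cosparse UNIV)"
    using nice by (intro meromorphic_on_imp_analytic_cosparse) (simp add: nicely_meromorphic_on_def)
  \<comment> \<open>At this point of the strip \<open>R\<close> is given by an exponential. So
    \<open>R\<close> is not identically zero, and its zeros form a sparse set.\<close>
  moreover have "R (- of_real pi * \<i>) \<noteq> 0"
    using strip[of "- of_real pi * \<i>"] R_integral_nonzero by simp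
  then have "eventually (\<lambda>z. R z \<noteq> 0) (cosparse UNIV)"
    using nicely_meromorphic_imp_constant_or_avoid[OF nice open_UNIV connected_UNIV, of 0] by auto
  ultimately have "eventually (\<lambda>z. R analytic_on {z} \<and> R z \<noteq> 0) (cosparse UNIV)"
    by (rule eventually_conj)
  then have "countable ?Bad"
    using sparse_imp_countable[of UNIV ?Bad] by (simp add: eventually_cosparse)
  then have "countable {t::real. of_real t + s \<in> ?Bad}" for s
    by (intro countable_image_inj_on[of "\<lambda>t. complex_of_real t + s"])
       (auto intro: countable_subset[of _ ?Bad] inj_onI)
  then have "countable {t::real. let z = of_real t + s in \<not> R analytic_on {z} \<or> R z = 0}" for s
    by (simp add: Let_def)
  then show ?thesis
    unfolding singular_shifts_def by (intro countable_insert countable_UN) auto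
qed

definition separated :: "real set \<Rightarrow> real list \<Rightarrow> bool" where
  "separated D \<theta>s \<longleftrightarrow> (\<forall>n<length \<theta>s. \<forall>m<n. \<theta>s ! m - \<theta>s ! n \<notin> D)"

text \<open>The rapidities are perturbed one at a time: each new one has to avoid only countably
  many values, and an open interval is uncountable.\<close>

lemma separated_dense:
  assumes "countable D" "\<epsilon> > 0"
  shows "\<exists>\<theta>s'. length \<theta>s' = length \<theta>s \<and> separated D \<theta>s' \<and> (\<forall>n<length \<theta>s. \<bar>\<theta>s' ! n - \<theta>s ! n\<bar> < \<epsilon>)"
proof (induction \<theta>s rule: rev_induct)
  case Nil
  show ?case by (simp add: separated_def)
next
  case (snoc x \<theta>s)
  then obtain \<theta>s' where \<theta>s': "length \<theta>s' = length \<theta>s" "separated D \<theta>s'"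
    "\<forall>n<length \<theta>s. \<bar>\<theta>s' ! n - \<theta>s ! n\<bar> < \<epsilon>" by blast
  define B where "B = (\<Union>m\<in>{..<length \<theta>s'}. (\<lambda>d. \<theta>s' ! m - d) ` D)"
  have "countable B" unfolding B_def using assms(1) by (intro countable_UN countable_image) auto
  moreover have "uncountable {x - \<epsilon><..<x + \<epsilon>}"
    using assms(2) by (simp add: uncountable_open_interval)
  ultimately have "\<not> {x - \<epsilon><..<x + \<epsilon>} \<subseteq> B" using countable_subset by blast
  then obtain y where y: "y \<in> {x - \<epsilon><..<x + \<epsilon>}" "y \<notin> B" by blast
  have "\<theta>s' ! m - y \<notin> D" if "m < length \<theta>s'" for m
  proof
    assume "\<theta>s' ! m - y \<in> D"
    then have "y \<in> B" unfolding B_def using that by (intro UN_I[of m]) (auto intro: image_eqI[of _ _ "\<theta>s' ! m - y"])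
    with y(2) show False by simp
  qed
  then have "separated D (\<theta>s' @ [y])"
    using \<theta>s'(2) by (auto simp: separated_def nth_append less_Suc_eq)
  moreover have "\<forall>n<length (\<theta>s @ [x]). \<bar>(\<theta>s' @ [y]) ! n - (\<theta>s @ [x]) ! n\<bar> < \<epsilon>"
    using \<theta>s' y(1) by (auto simp: nth_append less_Suc_eq)
  ultimately show ?case using \<theta>s'(1) by (intro exI[of _ "\<theta>s' @ [y]"]) auto
qed

lemma norm_y_val:
  assumes "n < length \<theta>s"
  shows "cmod (y_val L ks (map (\<lambda>\<theta>. exp (of_real \<theta>)) \<theta>s) n j) = exp (\<theta>s ! n)"
proof -
  have "cmod (omega_pow L ((of_nat (ks ! n) + 1 - 2 * of_nat j) / 2)) = 1"
    by (rule norm_omega_pow) simp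
  then show ?thesis using assms by (simp add: y_val_def norm_mult)
qed

text \<open>Since \<open>p\<close> is real, both the zeros and the poles of \<open>f_fun\<close> lie
  on the unit circle.\<close>

lemma f_fun_nonzero:
  assumes "cmod z \<noteq> 1"
  shows "f_fun L p z \<noteq> 0"
proof -
  have "z \<noteq> omega_pow L c" if "Im c = 0" for c
    using norm_omega_pow[OF that] assms by metis
  moreover have "z \<noteq> 1" using assms by auto
  ultimately show ?thesis by (simp add: f_fun_def)
qed

context
  fixes L :: nat and R :: "complex \<Rightarrow> complex" and ks :: "nat list" and \<theta>s :: "real list"
  assumes ks: "set ks \<subseteq> {1..L - 1}" and len: "length \<theta>s = length ks"
begin

text \<open>At real rapidities the modulus of \<open>y_val\<close> is the exponential of the
  rapidity, whatever the inner index, and distinct rapidities have distinct exponentials.\<close>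

lemma norm_y_ratio:
  assumes "0 \<in> D" "separated D \<theta>s" "m < n" "n < length ks"
  defines "y \<equiv> y_val L ks (map (\<lambda>\<theta>. exp (of_real \<theta>)) \<theta>s)"
  shows "cmod (y m i / y n j) \<noteq> 1" "cmod (y n j / y m i) \<noteq> 1"
proof -
  have "\<theta>s ! m - \<theta>s ! n \<notin> D" using assms(2-4) len by (simp add: separated_def)
  then have "\<theta>s ! m \<noteq> \<theta>s ! n" using assms(1) by auto
  then show "cmod (y m i / y n j) \<noteq> 1" "cmod (y n j / y m i) \<noteq> 1"
    using assms len by (auto simp: norm_divide norm_y_val)
qed

lemma Phi_nonzero:
  assumes "0 \<in> D" "separated D \<theta>s"
  shows "Phi L p ks Ss (map (\<lambda>\<theta>. exp (of_real \<theta>)) \<theta>s) \<noteq> 0"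
  unfolding Phi_def Let_def
  using norm_y_ratio[OF assms] by (simp add: f_fun_nonzero)

lemma R_at_separated:
  assumes "separated (singular_shifts L R) \<theta>s" "m < n" "n < length ks"
    and "i \<in> {1..ks ! m}" "j \<in> {1..ks ! n}"
  defines "z \<equiv> of_real (\<theta>s ! m) - of_real (\<theta>s ! n) + R_shift L (ks ! m) (ks ! n) i j"
  shows "R analytic_on {z}" "R z \<noteq> 0"
proof -
  have "ks ! m \<in> {1..L - 1}" "ks ! n \<in> {1..L - 1}"
    using ks assms(2,3) by (meson less_trans nth_mem subsetD)+
  then have *: "ks ! m \<in> {..L}" "ks ! n \<in> {..L}" "i \<in> {..L}" "j \<in> {..L}"
    using assms(4,5) by auto
  have "\<theta>s ! m - \<theta>s ! n \<notin> singular_shifts L R"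
    using assms(1-3) len by (simp add: separated_def)
  then have "\<not> (let z = of_real (\<theta>s ! m - \<theta>s ! n) + R_shift L (ks ! m) (ks ! n) i j
      in \<not> R analytic_on {z} \<or> R z = 0)"
    using * unfolding singular_shifts_def by blast
  then show "R analytic_on {z}" "R z \<noteq> 0" by (auto simp: z_def Let_def)
qed

text \<open>\<open>V_op\<close> is 0 by convention off the regular points, so only evaluation at
  regular points carries information on \<open>J_fun\<close>.\<close>

lemma regular_point_separated:
  assumes "separated (singular_shifts L R) \<theta>s"
  shows "regular_point L R ks (map of_real \<theta>s)"
proof -
  have 0: "0 \<in> singular_shifts L R" by (simp add: singular_shifts_def)
  have not1: "z \<notin> {1, omega_pow L 1}" if "cmod z \<noteq> 1" for z
    using that norm_omega_pow[of 1 L] by auto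
  have map: "map exp (map of_real \<theta>s) = map (\<lambda>\<theta>. exp (complex_of_real \<theta>)) \<theta>s"
    by simp
  show ?thesis
    unfolding regular_point_def map Let_def
  proof (intro conjI allI impI ballI)
    fix n m i j assume *: "n < length ks" "m < n" "i \<in> {1..ks ! m}" "j \<in> {1..ks ! n}"
    show "R analytic_on {map of_real \<theta>s ! m - map of_real \<theta>s ! n + R_shift L (ks ! m) (ks ! n) i j}"
      using R_at_separated(1)[OF assms *(2,1,3,4)] * len by simp
    let ?y = "y_val L ks (map (\<lambda>\<theta>. exp (complex_of_real \<theta>)) \<theta>s)"
    show "?y m i / ?y n j \<notin> {1, omega_pow L 1}" "?y n j / ?y m i \<notin> {1, omega_pow L 1}"
      by (rule not1, rule norm_y_ratio[OF 0 assms *(2,1)])+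
  qed (use len in simp)
qed

text \<open>The prefactor, the constants \<open>lambda'\<close> and all factors \<open>R\<close> are
  nonzero at a separated point, so only \<open>J_fun\<close> can be responsible for a zero of the
  form factor.\<close>

lemma V_op_separated:
  assumes sep: "separated (singular_shifts L R) \<theta>s" and p: "0 < p" "p < 1" and L: "L \<ge> 2"
    and G: "G a \<noteq> 0" and V: "V_op L p R G a g ks (map of_real \<theta>s) = 0"
  shows "J_fun L p a g ks (map (\<lambda>\<theta>. exp (of_real \<theta>)) \<theta>s) = 0"
proof -
  have map: "map exp (map of_real \<theta>s) = map (\<lambda>\<theta>. exp (complex_of_real \<theta>)) \<theta>s"
    by simp
  have "sin (pi * p) > 0" using p by (intro sin_gt_zero) auto
  then have lam: "lambda' L p k \<noteq> 0" for k
    using L by (simp add: lambda'_def)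
  have "R_kl L R (ks ! m) (ks ! n) (map of_real \<theta>s ! m - map of_real \<theta>s ! n) \<noteq> 0"
    if "m < n" "n < length ks" for m n
    using R_at_separated(2)[OF sep that] that len by (simp add: R_kl_def)
  then have "(\<Prod>n<length ks. \<Prod>m<n. R_kl L R (ks ! m) (ks ! n) (map of_real \<theta>s ! m - map of_real \<theta>s ! n)) \<noteq> 0"
    by simp
  moreover have "(\<Prod>n<length ks. complex_of_real (lambda' L p (ks ! n))) \<noteq> 0"
    using lam by simp
  moreover have "f_factor L p R a g ks (map of_real \<theta>s) = 0"
    using V regular_point_separated[OF sep] ks G by (simp add: V_op_def)
  ultimately show ?thesis unfolding f_factor_def map by simp
qed

end

section \<open>Linearity in the algebra element, and monomial bases of the graded pieces\<close>

section \<open>Linearity\<close>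

abbreviation monomial_poly :: "(generator \<Rightarrow>\<^sub>0 nat) \<Rightarrow> poly_alg" where
  "monomial_poly \<mu> \<equiv> Poly_Mapping.single \<mu> 1"

lemma eval_poly_mon_val:
  "eval_poly \<phi> g = (\<Sum>\<mu>\<in>Poly_Mapping.keys g. Poly_Mapping.lookup g \<mu> * mon_val \<phi> \<mu>)"
  by (simp add: eval_poly_def mon_val_def)

lemma eval_poly_superset:
  assumes "finite A" "Poly_Mapping.keys g \<subseteq> A"
  shows "eval_poly \<phi> g = (\<Sum>\<mu>\<in>A. Poly_Mapping.lookup g \<mu> * mon_val \<phi> \<mu>)"
  unfolding eval_poly_mon_val using assms
  by (intro sum.mono_neutral_left) (auto simp: in_keys_iff)

lemma eval_poly_monomial: "eval_poly \<phi> (monomial_poly \<mu>) = mon_val \<phi> \<mu>"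
  by (simp add: eval_poly_mon_val)

lemma eval_poly_add: "eval_poly \<phi> (g + h) = eval_poly \<phi> g + eval_poly \<phi> h"
  unfolding eval_poly_mon_val
  by (rule setsum_keys_plus_distrib) (auto simp: distrib_right)

lemma lookup_poly_scale: "Poly_Mapping.lookup (poly_scale c g) \<mu> = c * Poly_Mapping.lookup g \<mu>"
  unfolding poly_scale_def mult_map_scale_conv_mult[symmetric]
  by (simp add: Poly_Mapping.map.rep_eq when_def)

lemma eval_poly_scale: "eval_poly \<phi> (poly_scale c g) = c * eval_poly \<phi> g"
proof -
  have "Poly_Mapping.keys (poly_scale c g) \<subseteq> Poly_Mapping.keys g"
    by (auto simp: in_keys_iff lookup_poly_scale)
  then show ?thesis
    by (simp add: eval_poly_superset[of "Poly_Mapping.keys g"] lookup_poly_scale sum_distrib_left mult_ac)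
qed

lemma J_fun_add: "J_fun L p a (g + h) ks xs = J_fun L p a g ks xs + J_fun L p a h ks xs"
  by (simp add: J_fun_def E_hom_def eval_poly_add distrib_left sum.distrib)

lemma J_fun_scale: "J_fun L p a (poly_scale c g) ks xs = c * J_fun L p a g ks xs"
  by (simp add: J_fun_def E_hom_def eval_poly_scale sum_distrib_left mult_ac)

lemma V_op_add: "V_op L p R G a (g + h) = V_op L p R G a g + V_op L p R G a h"
  by (auto simp: V_op_def f_factor_def J_fun_add fun_eq_iff algebra_simps)

lemma V_op_scale: "V_op L p R G a (poly_scale c g) = ff_scale c (V_op L p R G a g)"
  by (auto simp: V_op_def f_factor_def J_fun_scale ff_scale_def fun_eq_iff)

lemma linear_V_op: "Vector_Spaces.linear poly_scale ff_scale (V_op L p R G a)"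
  by (intro Vector_Spaces.linear.intro module_hom.intro module_hom_axioms.intro
      poly_alg.vector_space_axioms form_factors.vector_space_axioms
      poly_alg.module_axioms form_factors.module_axioms V_op_add V_op_scale)

lemma J_fun_sum:
  "J_fun L p a (\<Sum>\<mu>\<in>B. poly_scale (c \<mu>) (h \<mu>)) ks xs = (\<Sum>\<mu>\<in>B. c \<mu> * J_fun L p a (h \<mu>) ks xs)"
proof (induction B rule: infinite_finite_induct)
  case (insert \<mu> B)
  then show ?case by (simp add: J_fun_add J_fun_scale)
qed (simp_all add: J_fun_def E_hom_def eval_poly_def)

text \<open>All three kinds of spaces in the theorem have this form for suitable sets of monomials,
  so the dimension has to be computed only once, for a span of monomials.\<close>

lemma keys_subset_eq_span:
  "{g. Poly_Mapping.keys g \<subseteq> M} = poly_alg.span (monomial_poly ` M)"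
proof
  have expand: "g = (\<Sum>\<mu>\<in>Poly_Mapping.keys g. poly_scale (Poly_Mapping.lookup g \<mu>) (monomial_poly \<mu>))" for g :: poly_alg
  proof (rule poly_mapping_eqI)
    fix \<nu>
    have "Poly_Mapping.lookup (\<Sum>\<mu>\<in>Poly_Mapping.keys g. poly_scale (Poly_Mapping.lookup g \<mu>) (monomial_poly \<mu>)) \<nu>
      = (\<Sum>\<mu>\<in>Poly_Mapping.keys g. if \<mu> = \<nu> then Poly_Mapping.lookup g \<mu> else 0)"
      unfolding lookup_sum lookup_poly_scale by (intro sum.cong) (auto simp: lookup_single when_def)
    then show "Poly_Mapping.lookup g \<nu> =
      Poly_Mapping.lookup (\<Sum>\<mu>\<in>Poly_Mapping.keys g. poly_scale (Poly_Mapping.lookup g \<mu>) (monomial_poly \<mu>)) \<nu>"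
      by (simp add: in_keys_iff)
  qed
  show "{g. Poly_Mapping.keys g \<subseteq> M} \<subseteq> poly_alg.span (monomial_poly ` M)"
  proof
    fix g :: poly_alg assume "g \<in> {g. Poly_Mapping.keys g \<subseteq> M}"
    then show "g \<in> poly_alg.span (monomial_poly ` M)"
      by (subst expand, intro poly_alg.span_sum poly_alg.span_scale, intro poly_alg.span_base) auto
  qed
  show "poly_alg.span (monomial_poly ` M) \<subseteq> {g. Poly_Mapping.keys g \<subseteq> M}"
  proof (rule poly_alg.span_minimal)
    show "poly_alg.subspace {g. Poly_Mapping.keys g \<subseteq> M}"
    proof (rule poly_alg.subspaceI)
      fix g h :: poly_alg assume "g \<in> {g. Poly_Mapping.keys g \<subseteq> M}" "h \<in> {g. Poly_Mapping.keys g \<subseteq> M}"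
      then show "g + h \<in> {g. Poly_Mapping.keys g \<subseteq> M}"
        using Poly_Mapping.keys_add[of g h] by auto
    qed (auto simp: in_keys_iff lookup_poly_scale subset_iff)
  qed auto
qed

lemma alg_eq_span: "alg L l = poly_alg.span (monomial_poly ` monomials (generators L) l)"
  unfolding keys_subset_eq_span[symmetric] by (auto simp: alg_def monomials_def)

lemma alg_bar_eq_span: "alg_bar L l = poly_alg.span (monomial_poly ` monomials (generators_bar L) l)"
  unfolding keys_subset_eq_span[symmetric] by (auto simp: alg_bar_def monomials_def)

definition tensor_monomials :: "nat \<Rightarrow> nat \<Rightarrow> nat \<Rightarrow> (generator \<Rightarrow>\<^sub>0 nat) set" where
  "tensor_monomials L l l' = (\<lambda>(\<mu>, \<nu>). \<mu> + \<nu>) ` (monomials (generators L) l \<times> monomials (generators_bar L) l')"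

lemma alg_tensor_eq_span: "alg_tensor L l l' = poly_alg.span (monomial_poly ` tensor_monomials L l l')"
proof
  show "alg_tensor L l l' \<subseteq> poly_alg.span (monomial_poly ` tensor_monomials L l l')"
    unfolding alg_tensor_def
  proof (rule poly_alg.span_minimal[OF _ poly_alg.subspace_span], safe)
    fix g h assume "g \<in> alg L l" "h \<in> alg_bar L l'"
    then have "Poly_Mapping.keys (g * h) \<subseteq> tensor_monomials L l l'"
      using keys_mult[of g h] unfolding alg_def alg_bar_def tensor_monomials_def monomials_def by fast
    then show "g * h \<in> poly_alg.span (monomial_poly ` tensor_monomials L l l')"
      unfolding keys_subset_eq_span[symmetric] by simp
  qed
  show "poly_alg.span (monomial_poly ` tensor_monomials L l l') \<subseteq> alg_tensor L l l'"
    unfolding alg_tensor_def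
  proof (rule poly_alg.span_mono, safe)
    fix \<mu> assume "\<mu> \<in> tensor_monomials L l l'"
    then obtain \<mu>1 \<mu>2 where \<mu>: "\<mu> = \<mu>1 + \<mu>2" "\<mu>1 \<in> monomials (generators L) l"
      "\<mu>2 \<in> monomials (generators_bar L) l'" by (auto simp: tensor_monomials_def)
    then show "\<exists>g h. monomial_poly \<mu> = g * h \<and> g \<in> alg L l \<and> h \<in> alg_bar L l'"
      by (intro exI[of _ "monomial_poly \<mu>1"] exI[of _ "monomial_poly \<mu>2"])
         (auto simp: mult_single alg_def alg_bar_def monomials_def)
  qed
qed

text \<open>The two kinds of generators are disjoint, so both factors of a product monomial are
  recovered by restricting its exponents to one kind.\<close>

lemma tensor_monomials_card:
  "finite (tensor_monomials L l l')" "of_nat (card (tensor_monomials L l l')) = dim_F L l * dim_F L l'"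
proof -
  let ?M = "monomials (generators L) l" and ?N = "monomials (generators_bar L) l'"
  show "finite (tensor_monomials L l l')"
    unfolding tensor_monomials_def using generators_monomials(1) generators_bar_monomials(1) by blast
  have disj: "generators L \<inter> generators_bar L = {}"
    by (auto simp: generators_def generators_bar_def)
  have sep: "Poly_Mapping.lookup \<mu> v = (if v \<in> generators L then Poly_Mapping.lookup (\<mu> + \<nu>) v else 0)"
    "Poly_Mapping.lookup \<nu> v = (if v \<in> generators L then 0 else Poly_Mapping.lookup (\<mu> + \<nu>) v)"
    if "\<mu> \<in> ?M" "\<nu> \<in> ?N" for \<mu> \<nu> v
  proof -
    have "v \<notin> generators L \<Longrightarrow> v \<notin> Poly_Mapping.keys \<mu>" "v \<in> generators L \<Longrightarrow> v \<notin> Poly_Mapping.keys \<nu>"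
      using that disj by (auto simp: monomials_def)
    then show "Poly_Mapping.lookup \<mu> v = (if v \<in> generators L then Poly_Mapping.lookup (\<mu> + \<nu>) v else 0)"
      "Poly_Mapping.lookup \<nu> v = (if v \<in> generators L then 0 else Poly_Mapping.lookup (\<mu> + \<nu>) v)"
      by (auto simp: in_keys_iff lookup_add)
  qed
  have "inj_on (\<lambda>(\<mu>, \<nu>). \<mu> + \<nu>) (?M \<times> ?N)"
  proof (rule inj_onI, clarsimp)
    fix \<mu> \<nu> \<mu>' \<nu>' assume *: "\<mu> \<in> ?M" "\<nu> \<in> ?N" "\<mu>' \<in> ?M" "\<nu>' \<in> ?N" "\<mu> + \<nu> = \<mu>' + \<nu>'"
    then show "\<mu> = \<mu>' \<and> \<nu> = \<nu>'"
      by (intro conjI poly_mapping_eqI) (simp_all only: sep[of \<mu> \<nu>] sep[of \<mu>' \<nu>'])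
  qed
  then have "card (tensor_monomials L l l') = card ?M * card ?N"
    unfolding tensor_monomials_def by (simp add: card_image card_cartesian_product)
  then show "of_nat (card (tensor_monomials L l l')) = dim_F L l * dim_F L l'"
    by (simp add: generators_monomials(2) generators_bar_monomials(2))
qed

section \<open>From independent leading terms to the dimension of the space of operators\<close>

section \<open>Injectivity for generic parameters\<close>

definition configurations :: "nat \<Rightarrow> real set \<Rightarrow> (nat list \<times> real list) set" where
  "configurations L D =
     {(ks, \<theta>s). set ks \<subseteq> {1..L - 1} \<and> length \<theta>s = length ks \<and> separated D \<theta>s}"

definition J_conf :: "nat \<Rightarrow> real \<Rightarrow> (nat \<Rightarrow> complex) \<Rightarrow> (generator \<Rightarrow>\<^sub>0 nat) \<Rightarrow> nat list \<times> real list \<Rightarrow> complex" where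
  "J_conf L p a \<mu> = (\<lambda>(ks, \<theta>s). J_fun L p a (monomial_poly \<mu>) ks (map (\<lambda>\<theta>. exp (of_real \<theta>)) \<theta>s))"

lemma exp_poly_J_conf: "exp_poly L (\<lambda>a. J_conf L p a \<mu> t)"
  by (cases t) (simp add: J_conf_def exp_poly_J_fun)

lemma tendsto_mon_val:
  assumes "\<And>v. v \<in> Poly_Mapping.keys \<mu> \<Longrightarrow> ((\<lambda>x. \<phi> x v) \<longlongrightarrow> \<psi> v) F"
  shows "((\<lambda>x. mon_val (\<phi> x) \<mu>) \<longlongrightarrow> mon_val \<psi> \<mu>) F"
  unfolding mon_val_def using assms by (intro tendsto_prod tendsto_power) auto

lemma tendsto_top_val:
  assumes "(f \<longlongrightarrow> \<theta>) F"
  shows "((\<lambda>x. top_val L k (exp (of_real (f x))) v) \<longlongrightarrow> top_val L k (exp (of_real \<theta>)) v) F"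
proof (cases v)
  case (Gen i m)
  have "((\<lambda>x. omega_pow L c * exp (of_real (f x)) ^ m) \<longlongrightarrow> omega_pow L c * exp (complex_of_real \<theta>) ^ m) F" for c
    using assms by (intro tendsto_intros)
  then show ?thesis by (simp add: Gen)
next
  case (GenBar i m)
  have "((\<lambda>x. - (omega_pow L c * exp (of_real (f x)) powi (- int m))) \<longlongrightarrow>
      - (omega_pow L c * exp (complex_of_real \<theta>) powi (- int m))) F" for c
    using assms by (intro tendsto_intros) auto
  then show ?thesis by (simp add: GenBar)
qed

text \<open>The vanishing is given only at separated rapidities. By density and continuity it
  extends to all real rapidities, including repeated ones, which
  \<open>monomials_independent_on_sums\<close> requires because its lists may repeat a
  vector.\<close>

lemma top_values_independent:
  assumes D: "countable D" and B: "finite B"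
    and keys: "\<And>\<mu>. \<mu> \<in> B \<Longrightarrow> Poly_Mapping.keys \<mu> \<subseteq> generators L \<union> generators_bar L"
    and zero: "\<And>ks \<theta>s. (ks, \<theta>s) \<in> configurations L D \<Longrightarrow>
      (\<Sum>\<mu>\<in>B. c \<mu> * mon_val (\<lambda>v. \<Sum>n<length ks. top_val L (ks ! n) (exp (of_real (\<theta>s ! n))) v) \<mu>) = 0"
    and "\<mu> \<in> B"
  shows "c \<mu> = 0"
proof -
  define V where "V = (\<Union>\<mu>\<in>B. Poly_Mapping.keys \<mu>)"
  define P where "P ks \<theta>s = (\<Sum>\<mu>\<in>B. c \<mu> * mon_val (\<lambda>v. \<Sum>n<length ks. top_val L (ks ! n) (exp (of_real (\<theta>s ! n))) v) \<mu>)"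
    for ks and \<theta>s :: "real list"
  have P0: "P ks \<theta>s = 0" if ks: "set ks \<subseteq> {1..L - 1}" and len: "length \<theta>s = length ks" for ks \<theta>s
  proof -
    have "\<forall>N. \<exists>\<theta>s'. length \<theta>s' = length \<theta>s \<and> separated D \<theta>s' \<and>
        (\<forall>n<length \<theta>s. \<bar>\<theta>s' ! n - \<theta>s ! n\<bar> < inverse (real (Suc N)))"
      using separated_dense[OF D] by simp
    then obtain \<Theta> where \<Theta>: "\<And>N. length (\<Theta> N) = length \<theta>s" "\<And>N. separated D (\<Theta> N)"
      "\<And>N n. n < length \<theta>s \<Longrightarrow> \<bar>\<Theta> N ! n - \<theta>s ! n\<bar> < inverse (real (Suc N))"
      by metis
    have "(\<lambda>N. \<Theta> N ! n) \<longlonglongrightarrow> \<theta>s ! n" if "n < length ks" for n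
    proof -
      have "(\<lambda>N. \<Theta> N ! n - \<theta>s ! n) \<longlonglongrightarrow> 0"
        using \<Theta>(3)[of n] that len
        by (intro Lim_null_comparison[OF _ LIMSEQ_inverse_real_of_nat] always_eventually)
           (auto intro: less_imp_le)
      then show ?thesis by (simp add: LIM_zero_iff)
    qed
    then have "(\<lambda>N. P ks (\<Theta> N)) \<longlonglongrightarrow> P ks \<theta>s"
      unfolding P_def by (intro tendsto_sum tendsto_mult tendsto_const tendsto_mon_val tendsto_top_val) auto
    moreover have "P ks (\<Theta> N) = 0" for N
      unfolding P_def using ks len \<Theta> by (intro zero) (auto simp: configurations_def)
    ultimately show ?thesis using LIMSEQ_unique[of "\<lambda>_. 0"] by auto
  qed
  \<comment> \<open>A point of \<open>T\<close> is one particle, given by kind and rapidity. A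
    configuration is a list of such points, and its generator values are the sum of the
    corresponding \<open>\<gamma>\<close>.\<close>
  define T where "T = {1..L - 1} \<times> (UNIV :: real set)"
  define \<gamma> where "\<gamma> t = top_val L (fst t) (exp (of_real (snd t)))" for t :: "nat \<times> real"
  show ?thesis
  proof (rule monomials_independent_on_sums[of V B T \<gamma> c])
    show "finite V" using B by (simp add: V_def)
    fix d v assume d: "\<And>t. t \<in> T \<Longrightarrow> (\<Sum>v\<in>V. d v * \<gamma> t v) = 0"
    show "\<forall>v\<in>V. d v = 0"
    proof
      fix v assume "v \<in> V"
      show "d v = 0"
      proof (rule top_val_no_annihilator[OF \<open>finite V\<close>])
        show "V \<subseteq> generators L \<union> generators_bar L" using keys by (auto simp: V_def)
        fix k and \<theta> :: real assume "k \<in> {1..L - 1}"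
        then show "(\<Sum>v\<in>V. d v * top_val L k (exp (of_real \<theta>)) v) = 0"
          using d[of "(k, \<theta>)"] by (simp add: T_def \<gamma>_def)
      qed fact
    qed
  next
    fix ts assume ts: "set ts \<subseteq> T"
    have "P (map fst ts) (map snd ts) = 0"
      using ts by (intro P0) (auto simp: T_def)
    moreover have "(\<Sum>t\<leftarrow>ts. \<gamma> t v) =
        (\<Sum>n<length ts. top_val L (map fst ts ! n) (exp (of_real (map snd ts ! n))) v)" for v
      by (simp add: sum_list_sum_nth \<gamma>_def lessThan_atLeast0)
    ultimately show "(\<Sum>\<mu>\<in>B. c \<mu> * mon_val (\<lambda>v. \<Sum>t\<leftarrow>ts. \<gamma> t v) \<mu>) = 0"
      by (simp add: P_def)
  qed (use B \<open>\<mu> \<in> B\<close> in \<open>auto simp: V_def\<close>)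
qed

text \<open>\<open>F\<close> is the determinant of the values of \<open>J_conf\<close> at
  configurations chosen so that the determinant of the leading terms is nonzero. The latter is the
  limit of the row-rescaled former along the ray, so \<open>F\<close> is not identically zero; where
  \<open>F\<close> is nonzero, the linear system has only the trivial solution.\<close>

lemma exists_separating_function:
  assumes L: "L \<ge> 2" and D: "countable D" "0 \<in> D" and B: "finite B"
    and keys: "\<And>\<mu>. \<mu> \<in> B \<Longrightarrow> Poly_Mapping.keys \<mu> \<subseteq> generators L \<union> generators_bar L"
  shows "\<exists>F. entire_on_hdual L F \<and> (\<exists>a\<in>hdual L. F a \<noteq> 0) \<and>
    (\<forall>a c. F a \<noteq> 0 \<longrightarrow> (\<forall>t\<in>configurations L D. (\<Sum>\<mu>\<in>B. c \<mu> * J_conf L p a \<mu> t) = 0) \<longrightarrow> (\<forall>\<mu>\<in>B. c \<mu> = 0))"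
proof -
  obtain b where b: "bij_betw b {..<card B} B"
    using ex_bij_betw_nat_finite[OF B] by (auto simp: lessThan_atLeast0)
  define d where "d = card B"
  have b_in: "b i \<in> B" if "i < d" for i
    using b that by (auto simp: bij_betw_def d_def)
  have b_sum: "(\<Sum>\<mu>\<in>B. g \<mu>) = (\<Sum>i<d. g (b i))" for g :: "_ \<Rightarrow> complex"
    unfolding d_def by (rule sum.reindex_bij_betw[OF b, symmetric])
  define h where "h t i = (case t of (ks, \<theta>s) \<Rightarrow> Phi L p ks (top_tuple ks) (map (\<lambda>\<theta>. exp (of_real \<theta>)) \<theta>s) *
      E_hom L ks (top_tuple ks) (map (\<lambda>\<theta>. exp (of_real \<theta>)) \<theta>s) (monomial_poly (b i)))"
    for t :: "nat list \<times> real list" and i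
  have "\<exists>ts. (\<forall>j<d. ts j \<in> configurations L D) \<and> det (mat d d (\<lambda>(j, i). h (ts j) i)) \<noteq> 0"
  proof (rule exists_det_nonzero)
    fix c assume c: "\<And>t. t \<in> configurations L D \<Longrightarrow> (\<Sum>i<d. c i * h t i) = 0"
    define c' where "c' \<mu> = c (the_inv_into {..<d} b \<mu>)" for \<mu>
    have c': "c' (b i) = c i" if "i < d" for i
      using b that by (simp add: c'_def bij_betw_def the_inv_into_f_f d_def)
    have "c' \<mu> = 0" if "\<mu> \<in> B" for \<mu>
    proof (rule top_values_independent[OF D(1) B keys _ that])
      fix ks \<theta>s assume t: "(ks, \<theta>s) \<in> configurations L D"
      then have ks: "set ks \<subseteq> {1..L - 1}" "length \<theta>s = length ks" "separated D \<theta>s"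
        by (auto simp: configurations_def)
      let ?xs = "map (\<lambda>\<theta>. exp (complex_of_real \<theta>)) \<theta>s"
      let ?E = "\<lambda>v. \<Sum>n<length ks. top_val L (ks ! n) (exp (of_real (\<theta>s ! n))) v"
      have E: "E_hom L ks (top_tuple ks) ?xs (monomial_poly \<mu>) = mon_val ?E \<mu>" if "\<mu> \<in> B" for \<mu>
        unfolding E_hom_def eval_poly_monomial mon_val_def
        using keys[OF that] ks by (intro prod.cong) (auto simp: E_gen_top)
      \<comment> \<open>The factor \<open>Phi\<close> of the leading term is the same for all
        monomials and nonzero, so it can be cancelled.\<close>
      have "Phi L p ks (top_tuple ks) ?xs * (\<Sum>\<mu>\<in>B. c' \<mu> * mon_val ?E \<mu>) = (\<Sum>i<d. c i * h (ks, \<theta>s) i)"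
        unfolding b_sum sum_distrib_left
        by (intro sum.cong refl) (simp add: h_def c' E b_in)
      also have "\<dots> = 0" by (rule c[OF t])
      finally show "(\<Sum>\<mu>\<in>B. c' \<mu> * mon_val ?E \<mu>) = 0"
        using Phi_nonzero[OF ks(1,2) D(2) ks(3)] by simp
    qed
    then show "\<forall>i<d. c i = 0" using c' b_in by metis
  qed
  then obtain ts where ts: "\<And>j. j < d \<Longrightarrow> ts j \<in> configurations L D"
    and det: "det (mat d d (\<lambda>(j, i). h (ts j) i)) \<noteq> 0" by blast
  define F where "F a = det (mat d d (\<lambda>(j, i). J_conf L p a (b i) (ts j)))" for a
  have "entire_on_hdual L F"
    unfolding F_def by (intro exp_poly_imp_entire exp_poly_det exp_poly_J_conf)
  moreover have "\<exists>a\<in>hdual L. F a \<noteq> 0"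
  proof (rule ccontr)
    assume no: "\<not> (\<exists>a\<in>hdual L. F a \<noteq> 0)"
    \<comment> \<open>Each row is scaled by the inverse of its own dominant exponential. The scalars
      factor out of the determinant, so the rescaled determinant still vanishes along the ray if
      \<open>F\<close> does.\<close>
    define s where "s t j = complex_of_real (exp (- t * height L (top_tuple (fst (ts j)))))" for t j
    have lim: "((\<lambda>t. s t j * J_conf L p (ray L t) (b i) (ts j)) \<longlongrightarrow> h (ts j) i) at_top"
      if "j < d" for i j
    proof -
      obtain ks \<theta>s where t: "ts j = (ks, \<theta>s)" by (cases "ts j")
      then have "set ks \<subseteq> {1..L - 1}" using ts[OF that] by (auto simp: configurations_def)
      then show ?thesis
        unfolding s_def t J_conf_def h_def prod.case fst_conv by (rule J_fun_limit[OF L])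
    qed
    have "((\<lambda>t. det (mat d d (\<lambda>(j, i). s t j * J_conf L p (ray L t) (b i) (ts j))))
        \<longlongrightarrow> det (mat d d (\<lambda>(j, i). h (ts j) i))) at_top"
      unfolding det_mat using lim by (intro tendsto_intros) auto
    moreover have "det (mat d d (\<lambda>(j, i). s t j * J_conf L p (ray L t) (b i) (ts j))) = 0" for t
    proof -
      have "det (mat d d (\<lambda>(j, i). s t j * J_conf L p (ray L t) (b i) (ts j))) =
          (\<Prod>j=0..<d. s t j) * F (ray L t)"
        unfolding F_def det_mat sum_distrib_left prod.distrib by (simp only: mult_ac)
      then show ?thesis using no ray_in_hdual by auto
    qed
    ultimately show False using det by (simp add: tendsto_const_iff)
  qed
  moreover have "\<mu> \<in> B \<Longrightarrow> c \<mu> = 0"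
    if Fa: "F a \<noteq> 0" and zero: "\<forall>t\<in>configurations L D. (\<Sum>\<mu>\<in>B. c \<mu> * J_conf L p a \<mu> t) = 0" for a c \<mu>
  proof -
    have "c (b i) = 0" if "i < d" for i
    proof (rule det_nonzero_kernel[where c = "\<lambda>i. c (b i)"])
      show "det (mat d d (\<lambda>(j, i). J_conf L p a (b i) (ts j))) \<noteq> 0"
        using Fa by (simp add: F_def)
      fix j assume "j < d"
      then show "(\<Sum>i<d. J_conf L p a (b i) (ts j) * c (b i)) = 0"
        using ts zero by (simp add: b_sum mult.commute)
    qed fact
    moreover have "b ` {..<d} = B" using b by (simp add: bij_betw_def d_def)
    ultimately show "\<mu> \<in> B \<Longrightarrow> c \<mu> = 0" by blast
  qed
  ultimately show ?thesis by (intro exI[of _ F]) blast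
qed

text \<open>A linear relation among the operators of the monomials in \<open>B\<close>, evaluated at
  separated configurations, becomes the same relation among the values of \<open>J_conf\<close>, and
  \<open>inj\<close> makes it trivial.\<close>

lemma dim_V_op:
  assumes "L \<ge> 2" "0 < p" "p < 1" "G a \<noteq> 0" and B: "finite B"
    and inj: "\<And>c. \<forall>t\<in>configurations L (singular_shifts L R). (\<Sum>\<mu>\<in>B. c \<mu> * J_conf L p a \<mu> t) = 0 \<Longrightarrow>
      \<forall>\<mu>\<in>B. c \<mu> = 0"
  shows "form_factors.dim {V_op L p R G a g | g. g \<in> poly_alg.span (monomial_poly ` B)} = card B"
proof -
  let ?V = "V_op L p R G a"
  interpret V: Vector_Spaces.linear poly_scale ff_scale ?V by (rule linear_V_op)
  have indep: "\<forall>\<mu>\<in>B. c \<mu> = 0" if zero: "(\<Sum>\<mu>\<in>B. ff_scale (c \<mu>) (?V (monomial_poly \<mu>))) = 0" for c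
  proof (rule inj, safe)
    fix ks \<theta>s assume "(ks, \<theta>s) \<in> configurations L (singular_shifts L R)"
    then have t: "set ks \<subseteq> {1..L - 1}" "length \<theta>s = length ks" "separated (singular_shifts L R) \<theta>s"
      by (auto simp: configurations_def)
    have "?V (\<Sum>\<mu>\<in>B. poly_scale (c \<mu>) (monomial_poly \<mu>)) = 0"
      using zero by (simp add: V.sum V.scale)
    then have "J_fun L p a (\<Sum>\<mu>\<in>B. poly_scale (c \<mu>) (monomial_poly \<mu>)) ks (map (\<lambda>\<theta>. exp (of_real \<theta>)) \<theta>s) = 0"
      using assms t by (intro V_op_separated[where G = G and R = R]) auto
    then show "(\<Sum>\<mu>\<in>B. c \<mu> * J_conf L p a \<mu> (ks, \<theta>s)) = 0"
      by (simp add: J_fun_sum J_conf_def)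
  qed
  define W where "W \<mu> = ?V (monomial_poly \<mu>)" for \<mu>
  have "inj_on W B"
  proof (rule inj_onI, rule ccontr)
    fix \<mu> \<nu> assume *: "\<mu> \<in> B" "\<nu> \<in> B" "W \<mu> = W \<nu>" "\<mu> \<noteq> \<nu>"
    \<comment> \<open>Independence of the image as a set would not notice two monomials with the
      same operator. The relation with coefficients 1 and -1 rules this out, so the image has
      \<open>card B\<close> elements.\<close>
    define c where "c = (\<lambda>_. 0 :: complex)(\<mu> := 1, \<nu> := - 1)"
    have "(\<Sum>\<kappa>\<in>B. ff_scale (c \<kappa>) (W \<kappa>)) = (\<Sum>\<kappa>\<in>{\<mu>, \<nu>}. ff_scale (c \<kappa>) (W \<kappa>))"
      using * B by (intro sum.mono_neutral_right) (auto simp: c_def)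
    also have "\<dots> = 0" using * by (simp add: c_def)
    finally have "c \<mu> = 0" using indep *(1) by (simp add: W_def)
    then show False using *(4) by (simp add: c_def)
  qed
  have "form_factors.independent (W ` B)"
    unfolding form_factors.dependent_finite[OF finite_imageI[OF B]]
  proof safe
    fix u \<mu> assume u: "(\<Sum>v\<in>W ` B. ff_scale (u v) v) = 0" "\<mu> \<in> B" "u (W \<mu>) \<noteq> 0"
    then have "(\<Sum>\<mu>\<in>B. ff_scale (u (W \<mu>)) (W \<mu>)) = 0"
      using \<open>inj_on W B\<close> by (simp add: sum.reindex)
    then show False using indep[of "\<lambda>\<mu>. u (W \<mu>)"] u by (simp add: W_def)
  qed
  then have "form_factors.dim (form_factors.span (W ` B)) = card B"
    using \<open>inj_on W B\<close> by (metis form_factors.dim_span_eq_card_independent card_image)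
  moreover have "{?V g | g. g \<in> poly_alg.span (monomial_poly ` B)} = form_factors.span (W ` B)"
    using V.span_image[of "monomial_poly ` B"] by (auto simp: image_image W_def)
  ultimately show ?thesis by simp
qed

theorem proposition1:
  fixes L :: nat and p :: real
    and R :: "complex \<Rightarrow> complex"
    and G :: "(nat \<Rightarrow> complex) \<Rightarrow> complex"
  assumes "L \<ge> 2"
    and "0 < p" and "p < 1" and "p \<notin> \<rat>"
    and "is_R_continuation L p R"
    and "\<And>a. a \<in> hdual L \<Longrightarrow> G a \<noteq> 0"
  shows "generic L (\<lambda>a.
      (\<forall>l l'. of_nat (form_factors.dim {V_op L p R G a g | g. g \<in> alg_tensor L l l'})
                = dim_F L l * dim_F L l') \<and>
      (\<forall>l. of_nat (form_factors.dim {V_op L p R G a g | g. g \<in> alg L l}) = dim_F L l) \<and>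
      (\<forall>l. of_nat (form_factors.dim {V_op L p R G a g | g. g \<in> alg_bar L l}) = dim_F L l))"
proof -
  \<comment> \<open>The monomial bases of all the spaces in question. There are countably many, and
    each contributes one entire function whose zero set has to be avoided.\<close>
  define \<B> where "\<B> = range (\<lambda>(l, l'). tensor_monomials L l l') \<union>
    range (monomials (generators L)) \<union> range (monomials (generators_bar L))"
  let ?D = "singular_shifts L R"
  have D: "countable ?D" "0 \<in> ?D"
    using countable_singular_shifts[OF assms(5)] by (auto simp: singular_shifts_def)
  have B: "finite B" "\<And>\<mu>. \<mu> \<in> B \<Longrightarrow> Poly_Mapping.keys \<mu> \<subseteq> generators L \<union> generators_bar L"
    if "B \<in> \<B>" for B
  proof -
    show "finite B" using that generators_monomials(1) generators_bar_monomials(1) tensor_monomials_card(1)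
      by (auto simp: \<B>_def)
    fix \<mu> assume "\<mu> \<in> B"
    then show "Poly_Mapping.keys \<mu> \<subseteq> generators L \<union> generators_bar L"
      using that Poly_Mapping.keys_add unfolding \<B>_def tensor_monomials_def monomials_def by fastforce
  qed
  have "\<forall>B\<in>\<B>. \<exists>F. entire_on_hdual L F \<and> (\<exists>a\<in>hdual L. F a \<noteq> 0) \<and>
    (\<forall>a c. F a \<noteq> 0 \<longrightarrow> (\<forall>t\<in>configurations L ?D. (\<Sum>\<mu>\<in>B. c \<mu> * J_conf L p a \<mu> t) = 0) \<longrightarrow> (\<forall>\<mu>\<in>B. c \<mu> = 0))"
    by (intro ballI exists_separating_function[OF assms(1) D] B)
  from bchoice[OF this] obtain F where F: "\<forall>B\<in>\<B>. entire_on_hdual L (F B) \<and> (\<exists>a\<in>hdual L. F B a \<noteq> 0) \<and>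
    (\<forall>a c. F B a \<noteq> 0 \<longrightarrow> (\<forall>t\<in>configurations L ?D. (\<Sum>\<mu>\<in>B. c \<mu> * J_conf L p a \<mu> t) = 0) \<longrightarrow> (\<forall>\<mu>\<in>B. c \<mu> = 0))" ..
  show ?thesis unfolding generic_def
  proof (rule exI[of _ "F ` \<B>"], intro conjI ballI impI)
    show "countable (F ` \<B>)" unfolding \<B>_def by (intro countable_image countable_Un) auto
  next
    fix f assume "f \<in> F ` \<B>"
    then show "entire_on_hdual L f" "\<exists>a\<in>hdual L. f a \<noteq> 0" using F by blast+
  next
    fix a assume a: "a \<in> hdual L" "a \<notin> (\<Union>f\<in>F ` \<B>. {b \<in> hdual L. f b = 0})"
    have dim: "form_factors.dim {V_op L p R G a g | g. g \<in> poly_alg.span (monomial_poly ` B)} = card B"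
      if that: "B \<in> \<B>" for B
    proof (rule dim_V_op[where G = G, OF assms(1-3) assms(6)[OF a(1)] B(1)[OF that]])
      fix c assume "\<forall>t\<in>configurations L ?D. (\<Sum>\<mu>\<in>B. c \<mu> * J_conf L p a \<mu> t) = 0"
      moreover have "F B a \<noteq> 0" using a that by blast
      ultimately show "\<forall>\<mu>\<in>B. c \<mu> = 0" using F that by blast
    qed
    have "tensor_monomials L l l' \<in> \<B>" "monomials (generators L) l \<in> \<B>"
      "monomials (generators_bar L) l \<in> \<B>" for l l'
      by (auto simp: \<B>_def)
    then show "\<forall>l l'. of_nat (form_factors.dim {V_op L p R G a g | g. g \<in> alg_tensor L l l'})
        = dim_F L l * dim_F L l'"
      "\<forall>l. of_nat (form_factors.dim {V_op L p R G a g | g. g \<in> alg L l}) = dim_F L l"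
      "\<forall>l. of_nat (form_factors.dim {V_op L p R G a g | g. g \<in> alg_bar L l}) = dim_F L l"
      by (simp_all add: alg_tensor_eq_span alg_eq_span alg_bar_eq_span dim tensor_monomials_card(2)
          generators_monomials(2) generators_bar_monomials(2))
  qed
qed

end
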